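(* The following hold for arbitrary stable blow-ups (with nonempty bags). (i) A stable blow-up of a chordless cycle $C_\ell$ is an exact $5$-leaf power if and only if $\ell$ is even. (ii) A stable blow-up of the ladder $L_t$ ($t\ge1$) is an exact $5$-leaf power if and only if $t\le2$. (iii) A stable blow-up of a cactus $F$ is an exact $5$-leaf power if and only if $F$ is bipartite. (iv) For every $k\ge3$, a stable blow-up of a complete multipartite graph $K_{n_1,\ldots,n_s}$ (with nonempty classes) is an exact $k$-leaf power if and only if $k$ is even or $s\le2$. (v) If $H$ is block-complete multipartite, then a stable blow-up of $H$ is an exact $5$-leaf power if and only if $H$ is bipartite.
   Context: Graphs are finite, simple, undirected and nonempty. A graph $G$ is an exact $k$-leaf power if there is a tree $T$ whose leaf set is $V(G)$ such that for distinct $u,v\in V(G)$, $uv\in E(G)$ if and only if $\operatorname{dist}_T(u,v)=k$; the vertex of a one-vertex tree counts as a leaf. A stable blow-up of a graph $H$ is a graph obtained by replacing each vertex $v\in V(H)$ by a nonempty (finite) stable set $I_v$ (these sets being pairwise disjoint), and adding all edges between $I_u$ and $I_v$ whenever $uv\in E(H)$ (and no other edges). $C_\ell$ is the cycle graph on $\ell$ vertices. For $t\ge1$, $L_t$ is the bipartite graph with parts $\{x_0,\ldots,x_t\}$ and $\{y_0,\ldots,y_t\}$ in which $x_iy_j$ is an edge if and only if $|i-j|\le1$ (so $L_t\cong P_{t+1}\square K_2$). A cactus is a connected graph every block of which is an edge or a cycle (or which is a single vertex). A connected graph is block-complete multipartite if every block of it is a complete multipartite graph. *)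

theory Defs
  imports "Graph_Theory.Graph_Theory"
begin

text \<open>
  Finite simple undirected graphs are \<^locale>\<open>pair_graph\<close>s: finite, loop-free, symmetric
  relations on a vertex set.
\<close>

section \<open>Trees and exact leaf powers\<close>

text \<open>
  In a symmetric digraph the closed walk \<open>u, v, u\<close> is a \<^const>\<open>pre_digraph.cycle\<close> of length 2, so
  \<^const>\<open>tree\<close> does not describe undirected trees; only cycles of length at least 3 are excluded
  here.
\<close>

definition undirected_tree :: "'a pair_pre_digraph \<Rightarrow> bool" where
  "undirected_tree T \<longleftrightarrow> pair_graph T \<and> Digraph_Component.connected (with_proj T) \<and>
     \<not> (\<exists>p. pre_digraph.cycle (with_proj T) p \<and> length p \<ge> 3)"

definition leaves :: "'a pair_pre_digraph \<Rightarrow> 'a set" where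
  "leaves T = {v \<in> pverts T. out_degree (with_proj T) v = 1 \<or> pverts T = {v}}"

abbreviation graph_dist :: "'a pair_pre_digraph \<Rightarrow> 'a \<Rightarrow> 'a \<Rightarrow> ereal" where
  "graph_dist G u v \<equiv> wf_digraph.\<mu> (with_proj G) (\<lambda>_. 1) u v"

text \<open>
  The leaves of the tree are the vertices of \<open>G\<close>, tagged with \<^const>\<open>Inl\<close>; the summand \<^typ>\<open>nat\<close>
  supplies as many internal vertices as a finite tree may need.
\<close>

definition exact_leaf_power :: "nat \<Rightarrow> 'a pair_pre_digraph \<Rightarrow> bool" where
  "exact_leaf_power k G \<longleftrightarrow>
     (\<exists>T :: ('a + nat) pair_pre_digraph.
        undirected_tree T \<and> leaves T = Inl ` pverts G \<and>
        (\<forall>u \<in> pverts G. \<forall>v \<in> pverts G. u \<noteq> v \<longrightarrow>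
           ((u, v) \<in> parcs G \<longleftrightarrow> graph_dist T (Inl u) (Inl v) = ereal (real k))))"


section \<open>Stable blow-ups\<close>

definition stable_blowup :: "'a pair_pre_digraph \<Rightarrow> 'b pair_pre_digraph \<Rightarrow> bool" where
  "stable_blowup H G \<longleftrightarrow>
     (\<exists>I :: 'a \<Rightarrow> 'b set.
        (\<forall>v \<in> pverts H. finite (I v) \<and> I v \<noteq> {}) \<and>
        disjoint_family_on I (pverts H) \<and>
        pverts G = (\<Union>v \<in> pverts H. I v) \<and>
        parcs G = (\<Union>(u, v) \<in> parcs H. I u \<times> I v))"


section \<open>Graph classes\<close>

text \<open>The formula gives the cycle on \<open>l\<close> vertices only for \<open>l \<ge> 3\<close>.\<close>

definition cycle_graph :: "nat \<Rightarrow> nat pair_pre_digraph" where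
  "cycle_graph l =
     \<lparr> pverts = {..<l},
       parcs = {(i, j). i < l \<and> j < l \<and> (j = Suc i mod l \<or> i = Suc j mod l)} \<rparr>"

text \<open>\<open>Inl i\<close> is the vertex $x_i$ and \<open>Inr j\<close> is the vertex $y_j$.\<close>

definition ladder :: "nat \<Rightarrow> (nat + nat) pair_pre_digraph" where
  "ladder t =
     (let E = {(Inl i, Inr j) | i j. i \<le> t \<and> j \<le> t \<and> \<bar>int i - int j\<bar> \<le> 1}
      in \<lparr> pverts = Inl ` {..t} \<union> Inr ` {..t}, parcs = E \<union> E\<inverse> \<rparr>)"

text \<open>\<open>(i, a)\<close> is the \<open>a\<close>-th vertex of the \<open>i\<close>-th class, which has \<open>ns ! i\<close> vertices.\<close>

definition complete_multipartite_graph :: "nat list \<Rightarrow> (nat \<times> nat) pair_pre_digraph" where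
  "complete_multipartite_graph ns =
     (let V = {(i, a). i < length ns \<and> a < ns ! i}
      in \<lparr> pverts = V, parcs = {(u, v) \<in> V \<times> V. fst u \<noteq> fst v} \<rparr>)"

definition bipartite :: "'a pair_pre_digraph \<Rightarrow> bool" where
  "bipartite G \<longleftrightarrow>
     (\<exists>X Y. pverts G = X \<union> Y \<and> X \<inter> Y = {} \<and> parcs G \<subseteq> X \<times> Y \<union> Y \<times> X)"

text \<open>
  Connected without a cut vertex. The null graph is not \<^const>\<open>Digraph_Component.connected\<close>,
  hence the guard for the one-vertex graph.
\<close>

definition nonseparable :: "('a, 'b) pre_digraph \<Rightarrow> bool" where
  "nonseparable B \<longleftrightarrow> Digraph_Component.connected B \<and>
     (\<forall>v \<in> verts B. verts B \<noteq> {v} \<longrightarrow> Digraph_Component.connected (pre_digraph.del_vert B v))"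

text \<open>
  The requirement \<^const>\<open>graph\<close> restricts the maximality to symmetric subdigraphs, i.e. to
  undirected subgraphs.
\<close>

definition is_block :: "'a pair_pre_digraph \<Rightarrow> 'a pair_pre_digraph \<Rightarrow> bool" where
  "is_block B G \<longleftrightarrow>
     pre_digraph.max_subgraph (with_proj G) (\<lambda>B. graph B \<and> nonseparable B) (with_proj B)"

definition cactus :: "'a pair_pre_digraph \<Rightarrow> bool" where
  "cactus F \<longleftrightarrow> pair_graph F \<and> Digraph_Component.connected (with_proj F) \<and>
     (card (pverts F) = 1 \<or>
      (\<forall>B. is_block B F \<longrightarrow>
         complete_digraph 2 (with_proj B) \<or>
         (\<exists>l \<ge> 3. digraph_iso (with_proj (cycle_graph l)) (with_proj B))))"

definition block_complete_multipartite :: "'a pair_pre_digraph \<Rightarrow> bool" where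
  "block_complete_multipartite H \<longleftrightarrow> pair_graph H \<and> Digraph_Component.connected (with_proj H) \<and>
     (\<forall>B. is_block B H \<longrightarrow>
        (\<exists>ns. ns \<noteq> [] \<and> (\<forall>n \<in> set ns. n \<ge> 1) \<and>
           digraph_iso (with_proj (complete_multipartite_graph ns)) (with_proj B)))"

end

theory Submission imports Defs "HOL-Library.Nat_Bijection"
begin

text \<open>
  Every finite tree is isomorphic to a finite prefix-closed set of words, in which each word is
  joined to its one-letter extensions: choose a root and spell out the path from it. The distance of
  two words is the sum of their lengths minus twice the length of their common prefix. All distances
  in trees are computed in this model, which gives a translation in both directions.

  \<^item> If the vertices of \<open>H\<close> are placed at words such that adjacency means distance \<open>k - 2\<close>, then every
    stable blow-up of \<open>H\<close> is an exact \<open>k\<close>-leaf power: take all prefixes of the words and hang the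
    vertices of the blow-up, as new leaves, at the words of their bags
    (\<open>blowup_exact_leaf_power\<close>). Vertices of one bag get distance 2.
  \<^item> Conversely, an exact \<open>k\<close>-leaf power assigns words to its vertices such that adjacency means
    distance \<open>k\<close>, and because the words belong to leaves, a detour through a third vertex wastes at
    least two steps (\<open>exact_leaf_power_leaf_words\<close>).

  For odd \<open>k\<close> the parity of the length is a proper 2-colouring, so only bipartite graphs qualify. This
  settles the negative direction for cycles, cacti, complete multipartite and block-complete
  multipartite graphs. For ladders the four-point condition of tree distances makes a ladder with
  two squares rigid: the two steps along each side are equally long, and opposite steps have sum 10
  (\<open>domino_rigid\<close>). With a third square, detours through the missing rungs show that some step is
  shorter than that (\<open>long_ladder_no_leaf_words\<close>).

  For the positive direction with \<open>k = 5\<close> a placement has to turn adjacency into distance 3. A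
  placement is kept injective with a prescribed vertex at the root and all other vertices at
  distance at least 3 from it (\<open>rooted_words\<close>). Such placements exist for complete bipartite graphs
  and for even cycles, with every vertex as root. If two graphs share one vertex, a placement of the
  second one rooted there can be planted, with new letters, at the word of that vertex in a
  placement of the first: distances between the two parts then are at least \<open>1 + 3\<close>, so no new
  adjacency arises. Splitting a connected graph at cut vertices down to its blocks shows that it has
  rooted placements as soon as its blocks have (\<open>rootable_if_blocks_rootable\<close>). The blocks
  of a bipartite cactus are edges and even cycles, and those of a bipartite block-complete
  multipartite graph are complete bipartite.
\<close>

section \<open>Distances between words\<close>

text \<open>
  The distance of two vertices in the tree of all words, where each word is joined to its one-letter
  extensions.
\<close>

fun wdist :: "'x list \<Rightarrow> 'x list \<Rightarrow> nat" where
  "wdist [] y = length y"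
| "wdist x [] = length x"
| "wdist (a # x) (b # y) = (if a = b then wdist x y else length x + length y + 2)"

fun lcp_length :: "'x list \<Rightarrow> 'x list \<Rightarrow> nat" where
  "lcp_length (a # x) (b # y) = (if a = b then Suc (lcp_length x y) else 0)"
| "lcp_length _ _ = 0"

lemma wdist_Nil2 [simp]: "wdist x [] = length x"
  by (cases x) auto

lemma wdist_lcp_length: "wdist x y + 2 * lcp_length x y = length x + length y"
  by (induction x y rule: wdist.induct) auto

lemma lcp_length_commute: "lcp_length x y = lcp_length y x"
  by (induction x y rule: lcp_length.induct) auto

text \<open>
  Two words that share a prefix with a third one share the shorter of these prefixes. The triangle
  inequality and the four-point condition below are linear consequences.
\<close>

lemma lcp_length_ultrametric: "min (lcp_length x y) (lcp_length y z) \<le> lcp_length x z"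
proof (induction x z arbitrary: y rule: lcp_length.induct)
  case (1 a x b z)
  show ?case
  proof (cases y)
    case (Cons c y')
    then show ?thesis using 1[of y'] by (auto simp: min_le_iff_disj)
  qed simp
next
  case ("2_1" z)
  then show ?case by (cases y) auto
next
  case ("2_2" x)
  then show ?case by (cases y; cases x) auto
qed

lemma wdist_commute: "wdist x y = wdist y x"
  using wdist_lcp_length[of x y] wdist_lcp_length[of y x] lcp_length_commute[of x y] by linarith

lemma wdist_eq_0_iff [simp]: "wdist x y = 0 \<longleftrightarrow> x = y"
  by (induction x y rule: wdist.induct) auto

lemma wdist_self [simp]: "wdist x x = 0"
  by simp

lemma wdist_append_same [simp]: "wdist (p @ x) (p @ y) = wdist x y"
  by (induction p) auto

lemma wdist_append_left [simp]: "wdist (p @ x) p = length x" "wdist p (p @ x) = length x"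
  using wdist_append_same[of p x "[]"] wdist_append_same[of p "[]" x] by simp_all

lemma wdist_map_inj: "inj h \<Longrightarrow> wdist (map h x) (map h y) = wdist x y"
  by (induction x y rule: wdist.induct) (auto dest: injD)

lemma even_wdist_iff: "even (wdist x y) \<longleftrightarrow> (even (length x) \<longleftrightarrow> even (length y))"
  using wdist_lcp_length[of x y] by presburger

lemma lcp_length_le: "lcp_length x y \<le> length x" "lcp_length x y \<le> length y"
  by (induction x y rule: lcp_length.induct) auto

lemma wdist_triangle: "wdist x z \<le> wdist x y + wdist y z"
  using wdist_lcp_length[of x y] wdist_lcp_length[of y z] wdist_lcp_length[of x z]
    lcp_length_ultrametric[of x y z] lcp_length_le[of x y] lcp_length_le[of y z]
  by (auto simp: min_def split: if_splits)

text \<open>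
  The four-point condition. By the ultrametric inequality \<open>lcp_length a b\<close> dominates one of
  \<open>lcp_length a c\<close>, \<open>lcp_length b c\<close> and one of \<open>lcp_length a d\<close>, \<open>lcp_length b d\<close>; likewise for
  \<open>lcp_length c d\<close>. In each case the sum of the two dominates one of the two sums that belong to the
  right-hand side.
\<close>

lemma four_point: "wdist a b + wdist c d \<le> max (wdist a c + wdist b d) (wdist a d + wdist b c)"
proof -
  let ?c = lcp_length
  have "?c a c \<le> ?c a b \<or> ?c b c \<le> ?c a b" "?c a d \<le> ?c a b \<or> ?c b d \<le> ?c a b"
    "?c a c \<le> ?c c d \<or> ?c a d \<le> ?c c d" "?c b c \<le> ?c c d \<or> ?c b d \<le> ?c c d"
    using lcp_length_ultrametric[of a c b] lcp_length_ultrametric[of a d b]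
      lcp_length_ultrametric[of c a d] lcp_length_ultrametric[of c b d]
    by (simp_all add: min_le_iff_disj lcp_length_commute[of c a] lcp_length_commute[of d b] lcp_length_commute[of c b] lcp_length_commute[of d a])
  then have "?c a c + ?c b d \<le> ?c a b + ?c c d \<or> ?c a d + ?c b c \<le> ?c a b + ?c c d"
    by (elim disjE) linarith+
  moreover have "wdist a b + wdist c d + 2 * (?c a b + ?c c d) = wdist a c + wdist b d + 2 * (?c a c + ?c b d)"
    "wdist a b + wdist c d + 2 * (?c a b + ?c c d) = wdist a d + wdist b c + 2 * (?c a d + ?c b c)"
    using wdist_lcp_length[of a b] wdist_lcp_length[of a c] wdist_lcp_length[of a d]
       wdist_lcp_length[of b c] wdist_lcp_length[of b d] wdist_lcp_length[of c d] by simp_all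
  ultimately show ?thesis
    by (auto simp: le_max_iff_disj)
qed

lemma wdist_1_iff: "wdist x y = 1 \<longleftrightarrow> (\<exists>a. y = x @ [a] \<or> x = y @ [a])"
proof (induction x y rule: wdist.induct)
  case (3 a x b y)
  then show ?case by auto
qed (auto simp: length_Suc_conv)

text \<open>
  The first step of the geodesic from \<open>x\<close> to \<open>y\<close>: it deletes the last letter of \<open>x\<close> unless \<open>x\<close> is a
  prefix of \<open>y\<close>. All words on the geodesic are prefixes of one of its ends, so it stays in every
  prefix-closed set that contains both.
\<close>

lemma word_step:
  assumes "x \<noteq> y"
  obtains z where "wdist x z = 1" "wdist x y = Suc (wdist z y)" "(\<exists>w. x = z @ w) \<or> (\<exists>w. y = z @ w)"
proof (cases "\<exists>w. y = x @ w")
  case True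
  then obtain w where w: "y = x @ w" by blast
  with assms obtain a w' where "w = a # w'" by (cases w) auto
  with w have y: "y = (x @ [a]) @ w'" by simp
  show ?thesis
    by (rule that[of "x @ [a]"]) (unfold y wdist_append_left, auto)
next
  case False
  then have "x \<noteq> []" by auto
  then obtain z a where x: "x = z @ [a]" by (cases x rule: rev_cases) auto
  from False have "wdist (z @ [a]) y = Suc (wdist z y)" unfolding x
  proof (induction z y rule: wdist.induct)
    case (1 y)
    then show ?case by (cases y) auto
  next
    case (3 c z b y)
    then show ?case by (cases "c = b") auto
  qed auto
  then show ?thesis
    by (intro that[of z]) (auto simp: x)
qed

lemma wdist_snoc_fresh:
  assumes "a \<noteq> b" "a \<notin> set y" "b \<notin> set x"
  shows "wdist (x @ [a]) (y @ [b]) = wdist x y + 2"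
  using assms
proof (induction x y rule: wdist.induct)
  case (1 y)
  then show ?case by (cases y) auto
qed auto

section \<open>Connectedness and cuts\<close>

text \<open>
  Arguments about connectedness split vertex sets, so connectedness is used in the form that every
  proper nonempty vertex set has an arc across its boundary. One direction follows a path out of
  the set, the other applies the criterion to the set of vertices reachable from \<open>u\<close>.
\<close>

lemma connected_iff_cut:
  assumes "wf_digraph D"
  shows "Digraph_Component.connected D \<longleftrightarrow> verts D \<noteq> {} \<and>
    (\<forall>X \<subset> verts D. X \<noteq> {} \<longrightarrow> (\<exists>a \<in> arcs D. (tail D a \<in> X) \<noteq> (head D a \<in> X)))"
    (is "_ \<longleftrightarrow> _ \<and> (\<forall>X \<subset> _. _ \<longrightarrow> ?crosses X)")
proof -
  interpret wf_digraph D by fact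
  define M where "M = with_proj (mk_symmetric D)"
  have V: "verts M = verts D" and E: "arcs_ends M = (\<Union>a \<in> arcs D. {(tail D a, head D a), (head D a, tail D a)})"
    unfolding M_def by (simp_all add: mk_symmetric_def)
  interpret M: wf_digraph M unfolding M_def wf_digraph_wp_iff by (rule wellformed_mk_symmetric)
  have step: "v \<rightarrow>\<^sup>*\<^bsub>M\<^esub> y" if "v \<rightarrow>\<^sup>*\<^bsub>M\<^esub> x" "(x, y) \<in> arcs_ends M" for v x y
    using that M.reachable_adj_trans by blast
  show ?thesis unfolding connected_def
  proof (intro iffI conjI allI impI)
    assume sc: "strongly_connected (with_proj (mk_symmetric D))"
    then show "verts D \<noteq> {}" by (simp add: strongly_connected_def mk_symmetric_def)
    fix X assume X: "X \<subset> verts D" "X \<noteq> {}"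
    then obtain x y where xy: "x \<in> X" "y \<in> verts D" "y \<notin> X" by blast
    show "?crosses X"
    proof (rule ccontr)
      assume no: "\<not> ?crosses X"
      have "x \<rightarrow>\<^sup>*\<^bsub>M\<^esub> y" using sc xy X unfolding strongly_connected_def M_def
        by (auto simp: mk_symmetric_def)
      then have "y \<in> X"
        unfolding reachable_def
        by (induction rule: rtrancl_on_induct) (use xy no in \<open>auto simp: E\<close>)
      with xy show False by blast
    qed
  next
    assume R: "verts D \<noteq> {} \<and> (\<forall>X \<subset> verts D. X \<noteq> {} \<longrightarrow> ?crosses X)"
    have "u \<rightarrow>\<^sup>*\<^bsub>M\<^esub> v" if uv: "u \<in> verts D" "v \<in> verts D" for u v
    proof (rule ccontr)
      assume un: "\<not> u \<rightarrow>\<^sup>*\<^bsub>M\<^esub> v"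
      define X where "X = {x \<in> verts D. u \<rightarrow>\<^sup>*\<^bsub>M\<^esub> x}"
      have "u \<in> X" using uv by (auto simp: X_def V)
      moreover have "v \<notin> X" using un by (simp add: X_def)
      ultimately have "X \<subset> verts D" "X \<noteq> {}" using uv by (auto simp: X_def)
      with R obtain a where a: "a \<in> arcs D" "(tail D a \<in> X) \<noteq> (head D a \<in> X)" by blast
      have "(tail D a, head D a) \<in> arcs_ends M" "(head D a, tail D a) \<in> arcs_ends M"
        using a(1) by (auto simp: E)
      with a step show False
        by (auto simp: X_def)
    qed
    with R show "strongly_connected (with_proj (mk_symmetric D))"
      unfolding strongly_connected_def M_def by (simp add: mk_symmetric_def)
  qed
qed

section \<open>Finite trees are prefix-closed sets of words\<close>

text \<open>
  Closure under prefixes takes the place of connectedness and acyclicity: the word of a vertex spells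
  out its path from the root, and this path stays inside \<open>T\<close>.
\<close>

definition tree_labelling :: "'a pair_pre_digraph \<Rightarrow> ('a \<Rightarrow> 'x list) \<Rightarrow> bool" where
  "tree_labelling T \<phi> \<longleftrightarrow> finite (pverts T) \<and> inj_on \<phi> (pverts T) \<and> [] \<in> \<phi> ` pverts T \<and>
     (\<forall>x y. x @ y \<in> \<phi> ` pverts T \<longrightarrow> x \<in> \<phi> ` pverts T) \<and>
     parcs T = {(u, v). u \<in> pverts T \<and> v \<in> pverts T \<and> wdist (\<phi> u) (\<phi> v) = 1}"

context
  fixes T :: "'a pair_pre_digraph" and \<phi> :: "'a \<Rightarrow> 'x list"
  assumes T: "tree_labelling T \<phi>"
begin

lemma labelled_arc_iff: "(u, v) \<in> parcs T \<longleftrightarrow> u \<in> pverts T \<and> v \<in> pverts T \<and> wdist (\<phi> u) (\<phi> v) = 1"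
  using T by (simp add: tree_labelling_def)

lemma labelled_inj: "u \<in> pverts T \<Longrightarrow> v \<in> pverts T \<Longrightarrow> \<phi> u = \<phi> v \<longleftrightarrow> u = v"
  using T by (auto simp: tree_labelling_def inj_on_def)

lemma labelled_pair_graph: "pair_graph T"
proof -
  have "parcs T \<subseteq> pverts T \<times> pverts T" by (auto simp: labelled_arc_iff)
  then have "finite (parcs T)"
    using T by (meson finite_SigmaI finite_subset tree_labelling_def)
  moreover have "sym (parcs T)"
    by (rule symI) (simp add: labelled_arc_iff wdist_commute)
  ultimately show ?thesis
    using T by unfold_locales (auto simp: labelled_arc_iff symmetric_def tree_labelling_def)
qed

lemma labelled_step:
  assumes "u \<in> pverts T" "v \<in> pverts T" "u \<noteq> v"
  obtains w where "(u, w) \<in> parcs T" "wdist (\<phi> u) (\<phi> v) = Suc (wdist (\<phi> w) (\<phi> v))"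
proof -
  have "\<phi> u \<noteq> \<phi> v" using assms labelled_inj by blast
  then obtain z where z: "wdist (\<phi> u) z = 1" "wdist (\<phi> u) (\<phi> v) = Suc (wdist z (\<phi> v))"
    "(\<exists>w. \<phi> u = z @ w) \<or> (\<exists>w. \<phi> v = z @ w)" by (rule word_step)
  have "z \<in> \<phi> ` pverts T"
    using T z(3) assms unfolding tree_labelling_def by (metis imageI)
  then obtain w where "w \<in> pverts T" "z = \<phi> w" by blast
  with z assms show ?thesis by (intro that[of w]) (auto simp: labelled_arc_iff)
qed

lemma labelled_walk_ge:
  assumes "pre_digraph.awalk (with_proj T) u p v"
  shows "wdist (\<phi> u) (\<phi> v) \<le> length p"
proof -
  interpret pair_graph T by (rule labelled_pair_graph)
  show ?thesis using assms
  proof (induction p arbitrary: u)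
    case Nil
    then show ?case by (simp add: awalk_Nil_iff)
  next
    case (Cons e p)
    then have "wdist (\<phi> u) (\<phi> (snd e)) = 1" "wdist (\<phi> (snd e)) (\<phi> v) \<le> length p"
      using labelled_arc_iff[of "fst e" "snd e"] by (auto simp: awalk_Cons_iff)
    then show ?case using wdist_triangle[of "\<phi> u" "\<phi> v" "\<phi> (snd e)"] by simp
  qed
qed

lemma labelled_walk:
  assumes "u \<in> pverts T" "v \<in> pverts T"
  shows "\<exists>p. pre_digraph.awalk (with_proj T) u p v \<and> length p = wdist (\<phi> u) (\<phi> v)"
proof -
  interpret pair_graph T by (rule labelled_pair_graph)
  show ?thesis using assms
  proof (induction "wdist (\<phi> u) (\<phi> v)" arbitrary: u)
    case 0
    then have "u = v" using labelled_inj by simp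
    then show ?case using 0 by (intro exI[of _ "[]"]) (simp add: awalk_Nil_iff)
  next
    case (Suc n)
    then have "u \<noteq> v" by auto
    with Suc.prems obtain w where w: "(u, w) \<in> parcs T" "wdist (\<phi> u) (\<phi> v) = Suc (wdist (\<phi> w) (\<phi> v))"
      by (rule labelled_step)
    then obtain p where "awalk w p v" "length p = wdist (\<phi> w) (\<phi> v)"
      using Suc by (metis Suc_inject labelled_arc_iff)
    then show ?case using w by (intro exI[of _ "(u, w) # p"]) (simp add: awalk_Cons_iff)
  qed
qed

text \<open>
  Every step of a walk changes the distance to the end by at most one, and stepping along geodesics
  of words attains the bound.
\<close>

lemma labelled_graph_dist:
  assumes "u \<in> pverts T" "v \<in> pverts T"
  shows "graph_dist T u v = ereal (real (wdist (\<phi> u) (\<phi> v)))"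
proof -
  interpret pair_graph T by (rule labelled_pair_graph)
  have cost: "awalk_cost (\<lambda>_. 1) p = real (length p)" for p :: "('a \<times> 'a) list"
    by (induction p) (auto simp: awalk_cost_def)
  obtain p where p: "awalk u p v" "length p = wdist (\<phi> u) (\<phi> v)"
    using labelled_walk[OF assms] by blast
  show ?thesis unfolding \<mu>_def cost
  proof (rule antisym)
    show "(INF p\<in>{p. awalk u p v}. ereal (real (length p))) \<le> ereal (real (wdist (\<phi> u) (\<phi> v)))"
      using p by (intro INF_lower2[of p]) auto
    show "ereal (real (wdist (\<phi> u) (\<phi> v))) \<le> (INF p\<in>{p. awalk u p v}. ereal (real (length p)))"
      by (rule INF_greatest) (use labelled_walk_ge in auto)
  qed
qed

lemma labelled_reachable:
  assumes "u \<in> pverts T" "v \<in> pverts T"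
  shows "u \<rightarrow>\<^sup>*\<^bsub>with_proj T\<^esub> v"
proof -
  interpret pair_graph T by (rule labelled_pair_graph)
  show ?thesis using labelled_walk[OF assms] reachable_awalk by blast
qed

lemma labelled_connected: "Digraph_Component.connected (with_proj T)"
proof -
  interpret pair_graph T by (rule labelled_pair_graph)
  have "pverts T \<noteq> {}" using T by (auto simp: tree_labelling_def)
  then show ?thesis
    using labelled_reachable unfolding connected_def strongly_connected_def
    by (auto intro: reachable_mk_symmetricI)
qed

lemma labelled_lower_neighbour:
  assumes "(u, v) \<in> parcs T" "length (\<phi> v) \<le> length (\<phi> u)"
  shows "\<phi> v = butlast (\<phi> u)"
  using assms by (auto simp: labelled_arc_iff wdist_1_iff simp del: One_nat_def)

text \<open>
  A vertex of a closed walk whose word is longest has only its parent word available as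
  predecessor and as successor. On a cycle with at least three vertices these two would be distinct.
\<close>

lemma labelled_acyclic:
  assumes "pre_digraph.cycle (with_proj T) p" 
  shows "length p < 3"
proof (rule ccontr)
  assume len: "\<not> length p < 3"
  interpret pair_graph T by (rule labelled_pair_graph)
  from assms obtain u where p: "awalk u p u" "distinct (tl (pawalk_verts u p))"
    by (auto simp: cycle_def)
  define n where "n = length p"
  have n: "n \<ge> 3" using len by (simp add: n_def)
  define c where "c i = fst (p ! i)" for i
  have arcs: "set p \<subseteq> parcs T" using p by (auto simp: awalk_def)
  have dist: "distinct (map snd p)"
  proof -
    have "pcas u p u" "p \<noteq> []" using p len by (auto simp: awalk_def)
    then show ?thesis using awalk_verts_conv'[of u p u] p by simp
  qed
  have chain: "snd (p ! i) = fst (p ! (Suc i mod n))" if "i < n" for i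
  proof -
    have "pcas u p u" using p by (auto simp: awalk_def)
    have gen: "\<And>u i. pcas u p v \<Longrightarrow> i < length p \<Longrightarrow> 
      fst (p ! 0) = u \<and> snd (p ! i) = (if Suc i = length p then v else fst (p ! Suc i))" for v and p :: "('a \<times> 'a) list"
    proof (induction p)
      case (Cons e p)
      show ?case
      proof (cases i)
        case 0
        then show ?thesis using Cons by (cases p) auto
      next
        case (Suc j)
        then show ?thesis using Cons.IH[of "snd e" j] Cons.prems by simp
      qed
    qed simp
    have "Suc i = n \<or> Suc i < n" using that by linarith
    then show ?thesis using gen[OF \<open>pcas u p u\<close>, of i] that unfolding n_def by (auto split: if_splits)
  qed
  define l where "l i = length (\<phi> (snd (p ! i)))" for i
  obtain i where i: "i < n" "\<And>j. j < n \<Longrightarrow> l j \<le> l i"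
  proof -
    have "finite (l ` {..<n})" "l ` {..<n} \<noteq> {}" using n by (auto simp: lessThan_empty_iff)
    then have "Max (l ` {..<n}) \<in> l ` {..<n}" "\<And>j. j < n \<Longrightarrow> l j \<le> Max (l ` {..<n})"
      by (auto intro: Max_in Max_ge)
    then obtain i where "i < n" "l i = Max (l ` {..<n})" by auto
    with \<open>\<And>j. j < n \<Longrightarrow> l j \<le> Max (l ` {..<n})\<close> show ?thesis using that by auto
  qed
  \<comment> \<open>Arc \<open>i\<close> ends at a vertex with a longest word; its neighbours on the cycle are the ends of the next arc \<open>j\<close> and of the previous arc \<open>k\<close>.\<close>
  define j where "j = Suc i mod n"
  define k where "k = (i + n - 1) mod n"
  have jk: "j < n" "k < n" using n by (auto simp: j_def k_def)
  have "Suc k mod n = i"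
  proof (cases "i = 0")
    case True
    then show ?thesis using n by (auto simp: k_def)
  next
    case False
    then have "k = i - 1" using i(1) by (simp add: k_def mod_if)
    then show ?thesis using False i(1) by simp
  qed
  have "k \<noteq> j"
    using n i(1) unfolding k_def j_def
    by (cases "i = 0"; cases "Suc i = n") (auto simp: mod_if)
  have "(snd (p ! i), snd (p ! j)) \<in> parcs T"
    using chain[OF i(1)] arcs nth_mem[of j p] jk by (auto simp: n_def j_def)
  moreover have "(snd (p ! i), snd (p ! k)) \<in> parcs T"
  proof -
    have "(fst (p ! i), snd (p ! i)) \<in> parcs T" using arcs nth_mem[of i p] i by (auto simp: n_def)
    then have "(snd (p ! k), snd (p ! i)) \<in> parcs T"
      using chain[OF jk(2)] \<open>Suc k mod n = i\<close> by simp
    then show ?thesis by (rule arcs_symmetric)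
  qed
  ultimately have "\<phi> (snd (p ! j)) = \<phi> (snd (p ! k))" "snd (p ! j) \<in> pverts T" "snd (p ! k) \<in> pverts T"
    using labelled_lower_neighbour i(2) jk by (metis l_def, simp_all add: labelled_arc_iff)
  then have "snd (p ! j) = snd (p ! k)" using labelled_inj by blast
  then show False
    using dist jk \<open>k \<noteq> j\<close> by (simp add: n_def distinct_conv_nth)
qed

lemma labelled_undirected_tree: "undirected_tree T"
  using labelled_pair_graph labelled_connected labelled_acyclic
  by (force simp: undirected_tree_def)

end

definition induced :: "'a pair_pre_digraph \<Rightarrow> 'a set \<Rightarrow> 'a pair_pre_digraph" where
  "induced G S = \<lparr> pverts = S, parcs = parcs G \<inter> S \<times> S \<rparr>"

lemma induced_simps [simp]: "pverts (induced G S) = S" "parcs (induced G S) = parcs G \<inter> S \<times> S"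
  by (simp_all add: induced_def)

lemma (in pair_graph) pair_graph_induced:
  assumes "S \<subseteq> pverts G"
  shows "pair_graph (induced G S)"
proof -
  have "finite S" using assms pair_finite_verts by (rule finite_subset)
  moreover have "sym (parcs G \<inter> S \<times> S)"
    by (auto intro!: symI arcs_symmetric)
  moreover have "finite (parcs G \<inter> S \<times> S)" using pair_finite_arcs by blast
  ultimately show ?thesis
    by unfold_locales (auto simp: symmetric_def dest: no_loops)
qed

lemma (in pair_graph) subgraph_induced:
  assumes "S \<subseteq> pverts G"
  shows "subgraph (with_proj (induced G S)) (with_proj G)"
proof -
  interpret S: pair_graph "induced G S" using assms by (rule pair_graph_induced)
  show ?thesis using assms by (auto simp: subgraph_def intro: wf_digraph S.wf_digraph)
qed

text \<open>
  Two distinct neighbours of \<open>w\<close> that are joined by a path avoiding \<open>w\<close> close a cycle.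
\<close>

lemma tree_unique_neighbour:
  assumes tree: "undirected_tree T" and S: "S \<subseteq> pverts T"
    and reach: "p \<rightarrow>\<^sup>*\<^bsub>with_proj (induced T S)\<^esub> q"
    and w: "w \<notin> S" "(p, w) \<in> parcs T" "(q, w) \<in> parcs T"
  shows "p = q"
proof (rule ccontr)
  assume "p \<noteq> q"
  interpret pair_graph T using tree by (simp add: undirected_tree_def)
  interpret S: pair_graph "induced T S" using S by (rule pair_graph_induced)
  obtain r where r: "S.apath p r q" using reach S.reachable_apath by blast
  have r': "apath p r q" using subgraph_apath_imp_apath[OF r subgraph_induced[OF S]] .
  have "set (pawalk_verts p r) \<subseteq> S"
    using S.awalkI_apath[OF r] unfolding S.awalk_conv by simp
  then have "w \<notin> set (pawalk_verts p r)" using w by blast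
  moreover have "pawalk_verts p (r @ [(q, w)]) = pawalk_verts p r @ [w]"
  proof -
    have "pcas p r q" using r' by (auto simp: apath_def awalk_def)
    then show ?thesis by (induction r arbitrary: p) auto
  qed
  moreover have "awalk p (r @ [(q, w)]) w"
    using r' w by (auto simp: apath_def awalk_simps dest: in_arcsD2)
  ultimately have "cycle ((w, p) # r @ [(q, w)])"
    unfolding cycle_def using r' w
    by (intro exI[of _ w]) (auto simp: awalk_Cons_iff apath_def intro: arcs_symmetric)
  moreover have "r \<noteq> []" using r' \<open>p \<noteq> q\<close> by (auto simp: apath_Nil_iff)
  then have "length ((w, p) # r @ [(q, w)]) \<ge> 3" by (cases r) auto
  ultimately show False using tree unfolding undirected_tree_def by blast
qed

text \<open>
  The labelling is extended vertex by vertex over larger and larger subtrees. A new vertex \<open>w\<close> that is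
  adjacent to a labelled vertex \<open>p\<close> has no other labelled neighbour, so it may receive the word of \<open>p\<close>
  followed by a new letter. The vertex \<open>w\<close> itself serves as this letter, since all words so far use only
  labelled vertices as letters.
\<close>

lemma undirected_tree_labelling:
  assumes tree: "undirected_tree T"
  obtains \<phi> :: "'a \<Rightarrow> 'a list" where "tree_labelling (T :: 'a pair_pre_digraph) \<phi>"
proof -
  interpret pair_graph T using tree by (simp add: undirected_tree_def)
  have conn: "pverts T \<noteq> {}" "\<And>X. X \<subset> pverts T \<Longrightarrow> X \<noteq> {} \<Longrightarrow> \<exists>a \<in> parcs T. (fst a \<in> X) \<noteq> (snd a \<in> X)"
    using tree connected_iff_cut[OF wf_digraph] by (auto simp: undirected_tree_def)
  have grow: "\<exists>S (\<phi> :: 'a \<Rightarrow> 'a list). S \<subseteq> pverts T \<and> card S = Suc n \<and> tree_labelling (induced T S) \<phi> \<and>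
      (\<forall>u \<in> S. set (\<phi> u) \<subseteq> S)" if "Suc n \<le> card (pverts T)" for n
    using that
  proof (induction n)
    case 0
    obtain r where "r \<in> pverts T" using conn(1) by blast
    then show ?case
      by (intro exI[of _ "{r}"] exI[of _ "\<lambda>_. []"]) (auto simp: tree_labelling_def dest: no_loops)
  next
    case (Suc n)
    then obtain S and \<phi> :: "'a \<Rightarrow> 'a list" where S: "S \<subseteq> pverts T" "card S = Suc n"
      and lab: "tree_labelling (induced T S) \<phi>" and letters: "\<forall>u \<in> S. set (\<phi> u) \<subseteq> S" by auto
    have "S \<subset> pverts T" "S \<noteq> {}" using S Suc.prems by auto
    then obtain p w where pw: "(p, w) \<in> parcs T" "p \<in> S" "w \<notin> S"
      using conn(2)[of S] arcs_symmetric by fastforce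
    have w: "w \<in> pverts T" using pw(1) by (rule in_arcsD2)
    define \<psi> where "\<psi> = \<phi>(w := \<phi> p @ [w])"
    have nbr: "(q, w) \<in> parcs T \<longleftrightarrow> q = p" if "q \<in> S" for q
    proof
      assume "(q, w) \<in> parcs T"
      then show "q = p"
        using tree_unique_neighbour[OF tree S(1) labelled_reachable[OF lab, of q p] pw(3) _ pw(1)] pw(2) that
        by simp
    qed (use pw in simp)
    have fresh: "w \<notin> set (\<phi> q)" if "q \<in> S" for q using letters pw that by blast
    have wdist_w: "wdist (\<phi> q) (\<phi> p @ [w]) = 1 \<longleftrightarrow> q = p" if "q \<in> S" for q
      using fresh[OF that] fresh[OF pw(2)] labelled_inj[OF lab, of q p] that pw(2)
      by (auto simp: wdist_1_iff simp del: One_nat_def)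
    have im: "\<psi> ` insert w S = insert (\<phi> p @ [w]) (\<phi> ` S)" using pw(3) by (auto simp: \<psi>_def)
    have "tree_labelling (induced T (insert w S)) \<psi>"
      unfolding tree_labelling_def induced_simps im
    proof (intro conjI allI impI)
      show "finite (insert w S)" "[] \<in> insert (\<phi> p @ [w]) (\<phi> ` S)"
        using lab by (auto simp: tree_labelling_def)
      have "inj_on \<psi> S \<longleftrightarrow> inj_on \<phi> S" using pw(3) by (intro inj_on_cong) (auto simp: \<psi>_def)
      then have "inj_on \<psi> S" using lab by (simp add: tree_labelling_def)
      moreover have "\<psi> w \<noteq> \<psi> q" if "q \<in> S" for q
      proof
        assume "\<psi> w = \<psi> q"
        then have "\<phi> q = \<phi> p @ [w]" using that pw(3) by (auto simp: \<psi>_def split: if_splits)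
        then show False using fresh[OF that] by simp
      qed
      ultimately show "inj_on \<psi> (insert w S)" using pw(3) by auto
      show "x \<in> insert (\<phi> p @ [w]) (\<phi> ` S)" if "x @ y \<in> insert (\<phi> p @ [w]) (\<phi> ` S)" for x y
      proof (cases "x @ y \<in> \<phi> ` S")
        case True
        then show ?thesis using lab by (auto simp: tree_labelling_def)
      next
        case False
        with that have xy: "x @ y = \<phi> p @ [w]" by blast
        show ?thesis
        proof (cases y rule: rev_cases)
          case (snoc y' b)
          then have "x @ y' \<in> \<phi> ` S" using xy pw(2) by auto
          then show ?thesis using lab unfolding tree_labelling_def induced_simps by blast
        qed (use xy in auto)
      qed
      show "parcs T \<inter> insert w S \<times> insert w S =
        {(u, v). u \<in> insert w S \<and> v \<in> insert w S \<and> wdist (\<psi> u) (\<psi> v) = 1}" (is "?L = ?R")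
      proof -
        have "(u, v) \<in> parcs T \<longleftrightarrow> wdist (\<psi> u) (\<psi> v) = 1" if "u \<in> insert w S" "v \<in> insert w S" for u v
        proof (cases "u = w"; cases "v = w")
          assume "u = w" "v = w"
          then show ?thesis using no_loops' by auto
        next
          assume "u = w" "v \<noteq> w"
          then have "(u, v) \<in> parcs T \<longleftrightarrow> v = p" using that nbr[of v] arcs_symmetric by blast
          then show ?thesis using \<open>u = w\<close> \<open>v \<noteq> w\<close> that wdist_w[of v]
            by (simp add: \<psi>_def wdist_commute[of "\<phi> p @ [w]" "\<phi> v"])
        next
          assume "u \<noteq> w" "v = w"
          then show ?thesis using that wdist_w nbr by (auto simp: \<psi>_def)
        next
          assume "u \<noteq> w" "v \<noteq> w"
          then show ?thesis using that labelled_arc_iff[OF lab, of u v] by (auto simp: \<psi>_def)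
        qed
        then show ?thesis by auto
      qed
    qed
    moreover have "\<forall>u \<in> insert w S. set (\<psi> u) \<subseteq> insert w S"
      using letters pw by (auto simp: \<psi>_def)
    moreover have "card (insert w S) = Suc (Suc n)"
      using S pw(3) finite_subset[OF S(1) pair_finite_verts] by simp
    moreover have "insert w S \<subseteq> pverts T" using S(1) w by blast
    ultimately show ?case by blast
  qed
  obtain n where n: "card (pverts T) = Suc n"
    using conn(1) pair_finite_verts by (metis card_eq_0_iff not0_implies_Suc)
  from grow[of n] obtain S and \<phi> :: "'a \<Rightarrow> 'a list" where S: "S \<subseteq> pverts T" "card S = card (pverts T)"
    and lab: "tree_labelling (induced T S) \<phi>" unfolding n by blast
  have "S = pverts T" using S pair_finite_verts card_subset_eq by blast
  moreover have "parcs T \<inter> pverts T \<times> pverts T = parcs T" by (auto dest: wellformed')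
  ultimately have "induced T S = T" by (simp add: induced_def)
  with lab show ?thesis using that by simp
qed

section \<open>Exact leaf powers in terms of words\<close>

lemma leaf_unique_neighbour:
  assumes "v \<in> leaves T" "(v, x) \<in> parcs T" "(v, y) \<in> parcs T" "pverts T \<noteq> {v}"
  shows "x = y"
proof -
  have "card (out_arcs (with_proj T) v) = 1" 
    using assms by (auto simp: leaves_def out_degree_def)
  then obtain e where "out_arcs (with_proj T) v = {e}" by (auto simp: card_1_singleton_iff)
  moreover have "(v, x) \<in> out_arcs (with_proj T) v" "(v, y) \<in> out_arcs (with_proj T) v"
    using assms by (auto simp: out_arcs_def)
  ultimately show ?thesis by auto
qed

text \<open>
  The first condition reads off adjacency from distances. The second one is the triangle inequality as
  improved for leaves: a path through the leaf \<open>v\<close> traverses the edge at \<open>v\<close> twice.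
\<close>

definition leaf_words :: "nat \<Rightarrow> 'a pair_pre_digraph \<Rightarrow> ('a \<Rightarrow> 'x list) \<Rightarrow> bool" where
  "leaf_words k G \<phi> \<longleftrightarrow>
     (\<forall>u \<in> pverts G. \<forall>v \<in> pverts G. u \<noteq> v \<longrightarrow> ((u, v) \<in> parcs G \<longleftrightarrow> wdist (\<phi> u) (\<phi> v) = k)) \<and>
     (\<forall>u \<in> pverts G. \<forall>v \<in> pverts G. \<forall>w \<in> pverts G. v \<noteq> u \<longrightarrow> v \<noteq> w \<longrightarrow>
       wdist (\<phi> u) (\<phi> w) + 2 \<le> wdist (\<phi> u) (\<phi> v) + wdist (\<phi> v) (\<phi> w))"

lemma exact_leaf_power_leaf_words:
  assumes "exact_leaf_power k G"
  shows "\<exists>\<phi> :: 'b \<Rightarrow> ('b + nat) list. leaf_words k G \<phi>"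
proof -
  from assms obtain T :: "('b + nat) pair_pre_digraph" where T: "undirected_tree T"
    and leaves: "leaves T = Inl ` pverts G"
    and E: "\<forall>u \<in> pverts G. \<forall>v \<in> pverts G. u \<noteq> v \<longrightarrow>
      ((u, v) \<in> parcs G \<longleftrightarrow> graph_dist T (Inl u) (Inl v) = ereal (real k))"
    unfolding exact_leaf_power_def by (elim exE conjE)
  obtain \<psi> :: "'b + nat \<Rightarrow> ('b + nat) list" where lab: "tree_labelling T \<psi>"
    using T by (rule undirected_tree_labelling)
  have V: "Inl u \<in> pverts T" if "u \<in> pverts G" for u
    using leaves that by (auto simp: leaves_def)
  have "leaf_words k G (\<psi> \<circ> Inl)"
    unfolding leaf_words_def
  proof (intro conjI ballI impI)
    fix u v assume "u \<in> pverts G" "v \<in> pverts G" "u \<noteq> v"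
    then show "(u, v) \<in> parcs G \<longleftrightarrow> wdist ((\<psi> \<circ> Inl) u) ((\<psi> \<circ> Inl) v) = k"
      using E labelled_graph_dist[OF lab V V] by simp
  next
    fix u v w assume uvw: "u \<in> pverts G" "v \<in> pverts G" "w \<in> pverts G" "v \<noteq> u" "v \<noteq> w"
    obtain a where a: "(Inl v, a) \<in> parcs T" "wdist (\<psi> (Inl v)) (\<psi> (Inl u)) = Suc (wdist (\<psi> a) (\<psi> (Inl u)))"
      using labelled_step[OF lab, of "Inl v" "Inl u"] uvw V by blast
    obtain b where b: "(Inl v, b) \<in> parcs T" "wdist (\<psi> (Inl v)) (\<psi> (Inl w)) = Suc (wdist (\<psi> b) (\<psi> (Inl w)))"
      using labelled_step[OF lab, of "Inl v" "Inl w"] uvw V by blast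
    have "Inl u \<in> pverts T" "Inl u \<noteq> Inl v" using uvw V by auto
    then have "pverts T \<noteq> {Inl v}" by (metis singletonD)
    then have "a = b"
      using leaf_unique_neighbour[of "Inl v" T a b] a(1) b(1) leaves uvw(2) by blast
    then show "wdist ((\<psi> \<circ> Inl) u) ((\<psi> \<circ> Inl) w) + 2 \<le> wdist ((\<psi> \<circ> Inl) u) ((\<psi> \<circ> Inl) v) + wdist ((\<psi> \<circ> Inl) v) ((\<psi> \<circ> Inl) w)"
      using a b wdist_triangle[of "\<psi> (Inl u)" "\<psi> (Inl w)" "\<psi> a"]
      by (simp add: wdist_commute[of "\<psi> (Inl u)"])
  qed
  then show ?thesis by blast
qed

text \<open>
  The tree consists of all prefixes of the words \<open>f g\<close> and of the leaves \<open>f g @ [h g]\<close>, where \<open>h g\<close> is a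
  letter that occurs nowhere else. Every nonempty prefix has a parent and a child. With at least two
  vertices the empty word has two children, because it is the place of some vertex. So there are no
  further leaves. The extra letters add 2 to all distances between distinct vertices.
\<close>

lemma exact_leaf_powerI:
  fixes f :: "'b \<Rightarrow> nat list"
  assumes fin: "finite (pverts G)" and root: "[] \<in> f ` pverts G"
    and E: "\<And>u v. u \<in> pverts G \<Longrightarrow> v \<in> pverts G \<Longrightarrow> u \<noteq> v \<Longrightarrow> (u, v) \<in> parcs G \<longleftrightarrow> wdist (f u) (f v) + 2 = k"
  shows "exact_leaf_power k G"
proof (cases "\<exists>g. pverts G = {g}")
  case True
  then obtain g where g: "pverts G = {g}" by blast
  \<comment> \<open>A leaf attached to the empty word would leave the empty word as a second leaf, so a single vertex is its own tree.\<close>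
  define T :: "('b + nat) pair_pre_digraph" where "T = \<lparr> pverts = {Inl g}, parcs = {} \<rparr>"
  have "tree_labelling T (\<lambda>_. [] :: nat list)" by (auto simp: tree_labelling_def T_def)
  then have "undirected_tree T" by (rule labelled_undirected_tree)
  moreover have "leaves T = Inl ` pverts G" by (auto simp: leaves_def T_def g)
  ultimately show ?thesis unfolding exact_leaf_power_def g by (intro exI[of _ T]) auto
next
  case False
  have "finite (\<Union>g \<in> pverts G. set (f g))" using fin by simp
  then obtain N where N: "\<And>g a. g \<in> pverts G \<Longrightarrow> a \<in> set (f g) \<Longrightarrow> a < N"
    by (auto simp: finite_nat_set_iff_bounded)
  obtain e :: "'b \<Rightarrow> nat" where e: "inj_on e (pverts G)"
    using finite_imp_inj_to_nat_seg[OF fin] by blast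
  define h where "h g = N + e g" for g
  have h_inj: "h g = h g' \<longleftrightarrow> g = g'" if "g \<in> pverts G" "g' \<in> pverts G" for g g'
    using e that by (auto simp: h_def inj_on_def)
  have h_fresh: "h g' \<notin> set (f g)" if "g \<in> pverts G" for g g'
    using N[OF that, of "h g'"] by (auto simp: h_def)
  define S where "S = (\<Union>g \<in> pverts G. (\<lambda>n. take n (f g)) ` {..length (f g)})"
  have S_iff: "x \<in> S \<longleftrightarrow> (\<exists>g \<in> pverts G. \<exists>y. f g = x @ y)" for x
  proof
    show "\<exists>g \<in> pverts G. \<exists>y. f g = x @ y" if "x \<in> S"
      using that unfolding S_def by (auto intro: append_take_drop_id[symmetric])
    show "x \<in> S" if "\<exists>g \<in> pverts G. \<exists>y. f g = x @ y"
    proof -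
      from that obtain g y where "g \<in> pverts G" "f g = x @ y" by blast
      then have "x = take (length x) (f g)" "length x \<le> length (f g)" by simp_all
      then show ?thesis unfolding S_def using \<open>g \<in> pverts G\<close> by blast
    qed
  qed
  have S_fresh: "h g \<notin> set x" if "x \<in> S" for g x
    using that h_fresh unfolding S_iff by fastforce
  define \<phi> where "\<phi> = case_sum (\<lambda>g. f g @ [h g]) list_decode"
  define V :: "('b + nat) set" where "V = Inl ` pverts G \<union> Inr ` list_encode ` S"
  define T where "T = \<lparr> pverts = V, parcs = {(u, v). u \<in> V \<and> v \<in> V \<and> wdist (\<phi> u) (\<phi> v) = 1} \<rparr>"
  have \<phi>_simps [simp]: "\<phi> (Inl g) = f g @ [h g]" "\<phi> (Inr (list_encode x)) = x" for g x
    by (simp_all add: \<phi>_def)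
  have im: "\<phi> ` V = (\<lambda>g. f g @ [h g]) ` pverts G \<union> S"
    unfolding V_def by (simp add: image_Un image_image)
  have prefix: "x \<in> \<phi> ` V" if "g \<in> pverts G" "f g @ [h g] = x @ y" for g x y
  proof (cases y rule: rev_cases)
    case Nil
    then show ?thesis using that by (auto simp: im)
  next
    case (snoc y' b)
    then have "f g = x @ y'" using that by simp
    then show ?thesis using that(1) by (auto simp: im S_iff)
  qed
  have lab: "tree_labelling T \<phi>"
    unfolding tree_labelling_def
  proof (intro conjI allI impI)
    have "finite S" using fin by (simp add: S_def)
    then show "finite (pverts T)" using fin by (simp add: T_def V_def)
    have "f g @ [h g] \<noteq> x" if "x \<in> S" for g x using S_fresh[OF that, of g] by auto
    then show "inj_on \<phi> (pverts T)"
      unfolding T_def V_def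
      by (auto simp: inj_on_def h_inj) metis+
    show "[] \<in> \<phi> ` pverts T" using prefix[of _ "[]"] root by (auto simp: T_def)
    show "x \<in> \<phi> ` pverts T" if "x @ y \<in> \<phi> ` pverts T" for x y
    proof -
      from that obtain g z where "g \<in> pverts G" "f g @ [h g] = (x @ y) @ z"
        unfolding T_def by (auto simp: im S_iff) (metis append_Nil2)
      then show ?thesis using prefix[of g x "y @ z"] by (simp add: T_def)
    qed
    show "parcs T = {(u, v). u \<in> pverts T \<and> v \<in> pverts T \<and> wdist (\<phi> u) (\<phi> v) = 1}"
      by (simp add: T_def)
  qed
  have "leaves T = Inl ` pverts G"
  proof (intro equalityI subsetI)
    fix u :: "'b + nat" assume u: "u \<in> Inl ` pverts G"
    then obtain g where g: "u = Inl g" "g \<in> pverts G" by blast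
    have fg: "f g \<in> S" using g by (auto simp: S_iff)
    have "(u, v) \<in> parcs T \<longleftrightarrow> v = Inr (list_encode (f g))" for v
    proof
      assume "(u, v) \<in> parcs T"
      then have v: "v \<in> V" and "wdist (f g @ [h g]) (\<phi> v) = 1" by (auto simp: T_def g)
      then consider b where "\<phi> v = f g @ [h g, b]" | b where "f g @ [h g] = \<phi> v @ [b]"
        by (auto simp: wdist_1_iff simp del: One_nat_def)
      then show "v = Inr (list_encode (f g))"
      proof cases
        case 1
        then show ?thesis
          using v S_fresh[of "\<phi> v" g] h_fresh
          by (auto simp: V_def append_eq_append_conv2 Cons_eq_append_conv)
             (metis in_set_conv_decomp h_fresh)+
      next
        case 2
        then have "\<phi> v = f g" by simp
        moreover have "h g' \<notin> set (f g)" for g' using h_fresh g by blast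
        ultimately show ?thesis using v fg by (auto simp: V_def) (metis in_set_conv_decomp)
      qed
    next
      assume "v = Inr (list_encode (f g))"
      then show "(u, v) \<in> parcs T" using g fg by (auto simp: T_def V_def)
    qed
    then have "out_arcs (with_proj T) u = {(u, Inr (list_encode (f g)))}"
      unfolding out_arcs_def with_proj_simps by force
    then have "out_degree (with_proj T) u = 1" by (simp add: out_degree_def)
    moreover have "u \<in> pverts T" using g by (simp add: T_def V_def)
    ultimately show "u \<in> leaves T" by (simp add: leaves_def)
  next
    fix u :: "'b + nat" assume leaf: "u \<in> leaves T"
    show "u \<in> Inl ` pverts G"
    proof (rule ccontr)
      assume "u \<notin> Inl ` pverts G"
      then obtain x where x: "x \<in> S" "u = Inr (list_encode x)" using leaf
        by (auto simp: leaves_def T_def V_def)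
      have ne: "pverts T \<noteq> {u}" using root x by (auto simp: T_def V_def)
      have nbr: "\<exists>v. (u, v) \<in> parcs T \<and> \<phi> v = y" if "wdist x y = 1" "y \<in> \<phi> ` V" for y
        using that x by (auto simp: T_def V_def)
      have unique: "y = z" if "wdist x y = 1" "y \<in> \<phi> ` V" "wdist x z = 1" "z \<in> \<phi> ` V" for y z
        using nbr[OF that(1,2)] nbr[OF that(3,4)] leaf_unique_neighbour[OF leaf _ _ ne] by blast
      have child: "\<exists>b y'. f g @ [h g] = x @ b # y' \<and> x @ [b] \<in> \<phi> ` V" if "g \<in> pverts G" "f g = x @ y" for g y
      proof -
        obtain b y' where b: "y @ [h g] = b # y'" by (cases y) auto
        then have "f g @ [h g] = x @ b # y'" using that(2) by simp
        then show ?thesis using prefix[OF that(1), of "x @ [b]" y'] by auto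
      qed
      from x obtain g y where g: "g \<in> pverts G" "f g = x @ y" by (auto simp: S_iff)
      obtain b y' where b: "f g @ [h g] = x @ b # y'" "x @ [b] \<in> \<phi> ` V" using child[OF g] by blast
      show False
      proof (cases x rule: rev_cases)
        case (snoc z c)
        then have "z \<in> \<phi> ` V" using g by (auto simp: im S_iff)
        then show False using unique[of z "x @ [b]"] b snoc
          by (auto simp: wdist_1_iff simp del: One_nat_def)
      next
        case Nil
        \<comment> \<open>The empty word is the place of \<open>g0\<close>, so the leaf of \<open>g0\<close> and a step towards another vertex \<open>g1\<close> are two children.\<close>
        obtain g0 where g0: "g0 \<in> pverts G" "f g0 = []" using root by auto
        obtain g1 where g1: "g1 \<in> pverts G" "g1 \<noteq> g0" using False g0 by blast
        obtain b y where b: "f g1 @ [h g1] = b # y" "[b] \<in> \<phi> ` V" using child[of g1 "f g1"] g1 Nil by auto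
        have "[h g0] \<in> \<phi> ` V" using prefix[of g0 "[h g0]" "[]"] g0 by simp
        then have "b = h g0" using unique[of "[h g0]" "[b]"] b Nil by simp
        then have "h g0 \<in> set (f g1 @ [h g1])" using b by simp
        then show False using h_fresh[of g1 g0] h_inj[of g0 g1] g0 g1 by simp
      qed
    qed
  qed
  moreover have "(u, v) \<in> parcs G \<longleftrightarrow> graph_dist T (Inl u) (Inl v) = ereal (real k)"
    if uv: "u \<in> pverts G" "v \<in> pverts G" "u \<noteq> v" for u v
  proof -
    have "wdist (f u @ [h u]) (f v @ [h v]) = wdist (f u) (f v) + 2"
    proof -
      have "h u \<noteq> h v" "h u \<notin> set (f v)" "h v \<notin> set (f u)" using uv h_inj h_fresh by auto
      then show ?thesis by (rule wdist_snoc_fresh)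
    qed
    moreover have "graph_dist T (Inl u) (Inl v) = ereal (real (wdist (\<phi> (Inl u)) (\<phi> (Inl v))))"
      using labelled_graph_dist[OF lab] uv by (simp add: T_def V_def)
    ultimately have "graph_dist T (Inl u) (Inl v) = ereal (real (wdist (f u) (f v) + 2))"
      by (simp only: \<phi>_simps)
    then show ?thesis using E[OF uv] by (simp only: ereal.inject of_nat_eq_iff)
  qed
  ultimately show ?thesis
    unfolding exact_leaf_power_def using labelled_undirected_tree[OF lab]
    by (intro exI[of _ T]) simp
qed

text \<open>
  The map that sends each vertex of a blow-up to the vertex of its bag.
\<close>

lemma stable_blowup_projection:
  assumes "stable_blowup H G" "parcs H \<subseteq> pverts H \<times> pverts H"
  obtains \<pi> where "\<pi> ` pverts G = pverts H"
    "\<forall>u \<in> pverts G. \<forall>v \<in> pverts G. (u, v) \<in> parcs G \<longleftrightarrow> (\<pi> u, \<pi> v) \<in> parcs H"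
proof -
  from assms(1) obtain I where I: "\<forall>v \<in> pverts H. finite (I v) \<and> I v \<noteq> {}"
    "disjoint_family_on I (pverts H)" "pverts G = (\<Union>v \<in> pverts H. I v)"
    "parcs G = (\<Union>(u, v) \<in> parcs H. I u \<times> I v)"
    unfolding stable_blowup_def by metis
  have uniq: "u = v" if "u \<in> pverts H" "v \<in> pverts H" "x \<in> I u" "x \<in> I v" for u v x
    using I(2) that by (auto simp: disjoint_family_on_def)
  obtain \<pi> where \<pi>: "\<And>x. x \<in> pverts G \<Longrightarrow> \<pi> x \<in> pverts H \<and> x \<in> I (\<pi> x)"
    using I(3) by (metis UN_E)
  have \<pi>_eq: "\<pi> x = v" if "v \<in> pverts H" "x \<in> I v" for x v
    using \<pi>[of x] uniq that I(3) by blast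
  show ?thesis
  proof (rule that[of \<pi>])
    show "\<pi> ` pverts G = pverts H" using \<pi> \<pi>_eq I(1,3) by (auto simp: image_iff)
    have "(u, v) \<in> parcs G \<longleftrightarrow> (\<pi> u, \<pi> v) \<in> parcs H" if "u \<in> pverts G" "v \<in> pverts G" for u v
    proof
      assume "(u, v) \<in> parcs G"
      then obtain a b where ab: "(a, b) \<in> parcs H" "u \<in> I a" "v \<in> I b" unfolding I(4) by blast
      then have "\<pi> u = a" "\<pi> v = b" using \<pi>_eq assms(2) by blast+
      with ab show "(\<pi> u, \<pi> v) \<in> parcs H" by simp
    next
      assume "(\<pi> u, \<pi> v) \<in> parcs H"
      moreover have "u \<in> I (\<pi> u)" "v \<in> I (\<pi> v)" using \<pi> that by simp_all
      ultimately show "(u, v) \<in> parcs G" unfolding I(4) by force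
    qed
    then show "\<forall>u \<in> pverts G. \<forall>v \<in> pverts G. (u, v) \<in> parcs G \<longleftrightarrow> (\<pi> u, \<pi> v) \<in> parcs H" by blast
  qed
qed

lemma blowup_exact_leaf_power:
  fixes f :: "'a \<Rightarrow> nat list"
  assumes G: "stable_blowup H G" and fin: "finite (pverts H)" and wf: "parcs H \<subseteq> pverts H \<times> pverts H"
    and root: "[] \<in> f ` pverts H"
    and E: "\<And>u v. u \<in> pverts H \<Longrightarrow> v \<in> pverts H \<Longrightarrow> (u, v) \<in> parcs H \<longleftrightarrow> wdist (f u) (f v) + 2 = k"
  shows "exact_leaf_power k G"
proof -
  obtain \<pi> where \<pi>: "\<pi> ` pverts G = pverts H"
    "\<forall>u \<in> pverts G. \<forall>v \<in> pverts G. (u, v) \<in> parcs G \<longleftrightarrow> (\<pi> u, \<pi> v) \<in> parcs H"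
    using G wf by (rule stable_blowup_projection)
  have "finite (pverts G)" using G fin by (auto simp: stable_blowup_def)
  then show ?thesis
  proof (rule exact_leaf_powerI[of G "f \<circ> \<pi>"])
    show "[] \<in> (f \<circ> \<pi>) ` pverts G" unfolding image_comp[symmetric] \<pi>(1) by (rule root)
    show "(u, v) \<in> parcs G \<longleftrightarrow> wdist ((f \<circ> \<pi>) u) ((f \<circ> \<pi>) v) + 2 = k" if "u \<in> pverts G" "v \<in> pverts G" for u v
      using \<pi> that E[of "\<pi> u" "\<pi> v"] by auto
  qed
qed

text \<open>
  Choosing one vertex from each bag embeds \<open>H\<close> into its blow-up as an induced subgraph.
\<close>

lemma leaf_words_blowup:
  assumes G: "stable_blowup H G" and wf: "parcs H \<subseteq> pverts H \<times> pverts H"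
    and \<psi>: "leaf_words k G \<psi>"
  shows "\<exists>\<phi>. leaf_words k H (\<psi> \<circ> \<phi>)"
proof -
  obtain \<pi> where \<pi>: "\<pi> ` pverts G = pverts H"
    "\<forall>u \<in> pverts G. \<forall>v \<in> pverts G. (u, v) \<in> parcs G \<longleftrightarrow> (\<pi> u, \<pi> v) \<in> parcs H"
    using G wf by (rule stable_blowup_projection)
  define \<rho> where "\<rho> = inv_into (pverts G) \<pi>"
  have \<rho>: "\<rho> v \<in> pverts G \<and> \<pi> (\<rho> v) = v" if "v \<in> pverts H" for v
    using that unfolding \<rho>_def \<pi>(1)[symmetric] by (simp add: inv_into_into f_inv_into_f)
  have \<rho>_inj: "\<rho> u \<noteq> \<rho> v" if "u \<in> pverts H" "v \<in> pverts H" "u \<noteq> v" for u v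
    using \<rho> that by metis
  have "leaf_words k H (\<psi> \<circ> \<rho>)"
    unfolding leaf_words_def
  proof (intro conjI ballI impI)
    fix u v assume "u \<in> pverts H" "v \<in> pverts H" "u \<noteq> v"
    then show "(u, v) \<in> parcs H \<longleftrightarrow> wdist ((\<psi> \<circ> \<rho>) u) ((\<psi> \<circ> \<rho>) v) = k"
      using \<psi>[unfolded leaf_words_def, THEN conjunct1, rule_format, of "\<rho> u" "\<rho> v"]
        \<pi>(2)[rule_format, of "\<rho> u" "\<rho> v"] \<rho>[of u] \<rho>[of v] \<rho>_inj[of u v] by simp
  next
    fix u v w assume "u \<in> pverts H" "v \<in> pverts H" "w \<in> pverts H" "v \<noteq> u" "v \<noteq> w"
    then show "wdist ((\<psi> \<circ> \<rho>) u) ((\<psi> \<circ> \<rho>) w) + 2 \<le> wdist ((\<psi> \<circ> \<rho>) u) ((\<psi> \<circ> \<rho>) v) + wdist ((\<psi> \<circ> \<rho>) v) ((\<psi> \<circ> \<rho>) w)"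
      using \<psi>[unfolded leaf_words_def, THEN conjunct2, rule_format, of "\<rho> u" "\<rho> v" "\<rho> w"]
        \<rho>[of u] \<rho>[of v] \<rho>[of w] \<rho>_inj[of v u] \<rho>_inj[of v w] by simp
  qed
  then show ?thesis by blast
qed

text \<open>
  Words at odd distance have lengths of different parity.
\<close>

lemma leaf_words_bipartite:
  assumes "leaf_words k H \<phi>" and wf: "parcs H \<subseteq> pverts H \<times> pverts H"
    and loopfree: "\<forall>v. (v, v) \<notin> parcs H" and k: "odd k"
  shows "bipartite H"
proof -
  define X where "X = {v \<in> pverts H. even (length (\<phi> v))}"
  have "parcs H \<subseteq> X \<times> (pverts H - X) \<union> (pverts H - X) \<times> X"
  proof
    fix e assume e: "e \<in> parcs H"
    obtain u v where "e = (u, v)" by (cases e)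
    with e have uv: "e = (u, v)" "u \<in> pverts H" "v \<in> pverts H" "u \<noteq> v"
      using wf loopfree by auto
    then have "wdist (\<phi> u) (\<phi> v) = k"
      using e assms(1)[unfolded leaf_words_def, THEN conjunct1, rule_format, of u v] by simp
    then have "odd (wdist (\<phi> u) (\<phi> v))" using k by simp
    then show "e \<in> X \<times> (pverts H - X) \<union> (pverts H - X) \<times> X" using uv by (auto simp: X_def even_wdist_iff)
  qed
  then show ?thesis unfolding bipartite_def by (intro exI[of _ X] exI[of _ "pverts H - X"]) (auto simp: X_def)
qed

section \<open>Ladders\<close>

text \<open>
  In each square the four-point condition bounds the sum of the two side distances by 10. For the
  missing rung from \<open>x0\<close> to \<open>y2\<close> the three sums of the points \<open>x0, x1, y1, y2\<close> are
  \<open>wdist x0 x1 + wdist y1 y2\<close>, \<open>10\<close> and \<open>wdist x0 y2 + 5\<close>, and the largest two are equal. As \<open>wdist x0 y2\<close> is odd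
  and not 5, the first sum is 10 or at least 12. The same holds for the rung from \<open>x2\<close> to \<open>y0\<close>.
  Together these inequalities leave no slack.
\<close>

lemma domino_rigid:
  assumes adj: "wdist x0 y0 = 5" "wdist x0 y1 = 5" "wdist x1 y0 = 5" "wdist x1 y1 = 5" "wdist x1 y2 = 5" "wdist x2 y1 = 5" "wdist x2 y2 = 5"
    and nonadj: "odd (wdist x0 y2)" "wdist x0 y2 \<noteq> 5" "odd (wdist x2 y0)" "wdist x2 y0 \<noteq> 5"
  shows "wdist x0 x1 = wdist x1 x2" "wdist y0 y1 = wdist y1 y2" "wdist x0 x1 + wdist y0 y1 = 10"
    "wdist x0 y2 \<le> 3" "wdist x2 y0 \<le> 3"
proof -
  have gap: "m \<le> 3 \<or> 7 \<le> m" if "odd m" "m \<noteq> 5" for m :: nat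
    using that by presburger
  have squares: "wdist x0 x1 + wdist y0 y1 \<le> 10" "wdist x1 x2 + wdist y1 y2 \<le> 10"
    using four_point[of x0 x1 y0 y1] four_point[of x1 x2 y1 y2] adj by simp_all
  have "10 \<le> max (wdist x0 x1 + wdist y1 y2) (wdist x0 y2 + 5)" "wdist x0 y2 + 5 \<le> max (wdist x0 x1 + wdist y1 y2) 10"
    using four_point[of x0 y1 x1 y2] four_point[of x0 y2 x1 y1] adj
    by (simp_all add: wdist_commute[of y1 x1] wdist_commute[of y2 x1] wdist_commute[of y2 y1] max.commute)
  then have 1: "10 \<le> wdist x0 x1 + wdist y1 y2" "7 \<le> wdist x0 y2 \<Longrightarrow> 12 \<le> wdist x0 x1 + wdist y1 y2"
    using gap[OF nonadj(1,2)] by (auto simp: le_max_iff_disj)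
  have "10 \<le> max (wdist x1 x2 + wdist y0 y1) (wdist x2 y0 + 5)" "wdist x2 y0 + 5 \<le> max (wdist x1 x2 + wdist y0 y1) 10"
    using four_point[of x1 y0 x2 y1] four_point[of x2 y0 x1 y1] adj
    by (simp_all add: wdist_commute[of y0 x2] wdist_commute[of y0 x1] wdist_commute[of x2 x1] max.commute)
  then have 2: "10 \<le> wdist x1 x2 + wdist y0 y1" "7 \<le> wdist x2 y0 \<Longrightarrow> 12 \<le> wdist x1 x2 + wdist y0 y1"
    using gap[OF nonadj(3,4)] by (auto simp: le_max_iff_disj)
  show "wdist x0 x1 = wdist x1 x2" "wdist y0 y1 = wdist y1 y2" "wdist x0 x1 + wdist y0 y1 = 10"
    using squares 1(1) 2(1) by linarith+
  show "wdist x0 y2 \<le> 3" "wdist x2 y0 \<le> 3"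
    using gap[OF nonadj(1,2)] gap[OF nonadj(3,4)] squares 1 2 by linarith+
qed

lemma leaf_wordsD:
  assumes "leaf_words k H \<phi>"
  shows "u \<in> pverts H \<Longrightarrow> v \<in> pverts H \<Longrightarrow> u \<noteq> v \<Longrightarrow> (u, v) \<in> parcs H \<longleftrightarrow> wdist (\<phi> u) (\<phi> v) = k"
    "u \<in> pverts H \<Longrightarrow> v \<in> pverts H \<Longrightarrow> w \<in> pverts H \<Longrightarrow> v \<noteq> u \<Longrightarrow> v \<noteq> w \<Longrightarrow>
       wdist (\<phi> u) (\<phi> w) + 2 \<le> wdist (\<phi> u) (\<phi> v) + wdist (\<phi> v) (\<phi> w)"
  using assms by (simp_all add: leaf_words_def)

lemma ladder_simps:
  "pverts (ladder t) = Inl ` {..t} \<union> Inr ` {..t}"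
  "(Inl i, Inr j) \<in> parcs (ladder t) \<longleftrightarrow> i \<le> t \<and> j \<le> t \<and> \<bar>int i - int j\<bar> \<le> 1"
  "(Inr j, Inl i) \<in> parcs (ladder t) \<longleftrightarrow> i \<le> t \<and> j \<le> t \<and> \<bar>int i - int j\<bar> \<le> 1"
  "(Inl i, Inl i') \<notin> parcs (ladder t)" "(Inr j, Inr j') \<notin> parcs (ladder t)"
  by (auto simp: ladder_def Let_def)

lemma parcs_ladder_subset: "parcs (ladder t) \<subseteq> pverts (ladder t) \<times> pverts (ladder t)"
  by (auto simp: ladder_def Let_def)

text \<open>
  Two overlapping ladders with two squares are rigid, so all steps on one side have the same length \<open>a\<close>
  and all steps on the other side have length \<open>10 - a\<close>. The missing rungs have length at most 3, and
  detours through them give \<open>a \<in> {4, 6}\<close>. If \<open>a = 4\<close>, then even the rung from \<open>x 0\<close> to \<open>y 3\<close> has length at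
  most 3, and the detour from \<open>y 2\<close> to \<open>y 3\<close> through \<open>x 0\<close> has length at most 6. So \<open>y 2\<close> and \<open>y 3\<close>
  have distance at most 4, although this distance is 6. The case \<open>a = 6\<close> is symmetric.
\<close>

lemma long_ladder_no_leaf_words:
  assumes "leaf_words 5 (ladder t) \<phi>" "3 \<le> t"
  shows False
proof -
  define x where "x i = \<phi> (Inl i)" for i
  define y where "y j = \<phi> (Inr j)" for j
  have xy: "wdist (x i) (y j) = 5 \<longleftrightarrow> \<bar>int i - int j\<bar> \<le> 1" if "i \<le> 3" "j \<le> 3" for i j
    using leaf_wordsD(1)[OF assms(1), of "Inl i" "Inr j"] that assms(2) by (simp add: ladder_simps x_def y_def)
  have diag: "even (length (x i)) \<longleftrightarrow> odd (length (y j))" if "i \<le> 3" "j \<le> 3" "\<bar>int i - int j\<bar> \<le> 1" for i j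
    using xy[OF that(1,2)] that(3) even_wdist_iff[of "x i" "y j"] by auto
  have px: "even (length (x i)) \<longleftrightarrow> even (length (x 0))" if "i \<le> 3" for i
  proof -
    have "i = 0 \<or> i = 1 \<or> i = 2 \<or> i = 3" using that by linarith
    then show ?thesis using diag[of 0 0] diag[of 1 0] diag[of 1 1] diag[of 2 1] diag[of 2 2] diag[of 3 2]
      by (elim disjE) simp_all
  qed
  have py: "even (length (y j)) \<longleftrightarrow> odd (length (x 0))" if "j \<le> 3" for j
    using diag[of j j] px[of j] that by simp
  have odd: "odd (wdist (x i) (y j))" if "i \<le> 3" "j \<le> 3" for i j
    using px[OF that(1)] py[OF that(2)] by (simp add: even_wdist_iff)
  have detour: "wdist (\<phi> u) (\<phi> w) + 2 \<le> wdist (\<phi> u) (\<phi> v) + wdist (\<phi> v) (\<phi> w)"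
    if "u \<in> Inl ` {..3} \<union> Inr ` {..3}" "v \<in> Inl ` {..3} \<union> Inr ` {..3}" "w \<in> Inl ` {..3} \<union> Inr ` {..3}"
      "v \<noteq> u" "v \<noteq> w" for u v w
    using leaf_wordsD(2)[OF assms(1), of u v w] that assms(2) by (auto simp: ladder_simps)
  have l: "wdist (x 0) (x 1) = wdist (x 1) (x 2)" "wdist (y 0) (y 1) = wdist (y 1) (y 2)" "wdist (x 0) (x 1) + wdist (y 0) (y 1) = 10"
    "wdist (x 0) (y 2) \<le> 3" "wdist (x 2) (y 0) \<le> 3"
    by (rule domino_rigid[of "x 0" "y 0" "y 1" "x 1" "y 2" "x 2"]; simp add: xy odd)+
  have r: "wdist (x 1) (x 2) = wdist (x 2) (x 3)" "wdist (y 1) (y 2) = wdist (y 2) (y 3)" "wdist (x 1) (x 2) + wdist (y 1) (y 2) = 10"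
    "wdist (x 1) (y 3) \<le> 3" "wdist (x 3) (y 1) \<le> 3"
    by (rule domino_rigid[of "x 1" "y 1" "y 2" "x 2" "y 3" "x 3"]; simp add: xy odd)+
  have "5 + 2 \<le> wdist (x 1) (x 0) + wdist (x 0) (y 2)"
    using detour[of "Inl 1" "Inl 0" "Inr 2"] xy[of 1 2] by (simp add: x_def y_def)
  then have x_ge: "4 \<le> wdist (x 0) (x 1)" using l(4) wdist_commute[of "x 1" "x 0"] by linarith
  have "5 + 2 \<le> wdist (x 2) (y 0) + wdist (y 0) (y 1)"
    using detour[of "Inl 2" "Inr 0" "Inr 1"] xy[of 2 1] by (simp add: x_def y_def)
  then have y_ge: "4 \<le> wdist (y 0) (y 1)" using l(5) by simp
  have "even (wdist (x 0) (x 1))" using px[of 1] by (simp add: even_wdist_iff)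
  then have "wdist (x 0) (x 1) = 4 \<or> wdist (x 0) (x 1) = 6" using x_ge y_ge l(3) by presburger
  then show False
  proof
    assume A: "wdist (x 0) (x 1) = 4"
    have "wdist (x 0) (y 3) + 2 \<le> wdist (x 0) (x 1) + wdist (x 1) (y 3)"
      using detour[of "Inl 0" "Inl 1" "Inr 3"] by (simp add: x_def y_def)
    then have "wdist (x 0) (y 3) \<le> 5" using A r(4) by simp
    moreover have "wdist (x 0) (y 3) \<noteq> 5" "odd (wdist (x 0) (y 3))" using xy[of 0 3] odd[of 0 3] by simp_all
    ultimately have "wdist (x 0) (y 3) \<le> 3" by presburger
    moreover have "wdist (y 2) (y 3) + 2 \<le> wdist (x 0) (y 2) + wdist (x 0) (y 3)"
      using detour[of "Inr 2" "Inl 0" "Inr 3"] by (simp add: x_def y_def wdist_commute[of "\<phi> (Inr 2)" "\<phi> (Inl 0)"])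
    ultimately show False using l r A by simp
  next
    assume A: "wdist (x 0) (x 1) = 6"
    have "wdist (x 3) (y 0) + 2 \<le> wdist (x 3) (y 1) + wdist (y 1) (y 0)"
      using detour[of "Inl 3" "Inr 1" "Inr 0"] by (simp add: x_def y_def)
    then have "wdist (x 3) (y 0) \<le> 5" using A r(5) l(3) wdist_commute[of "y 1" "y 0"] by linarith
    moreover have "wdist (x 3) (y 0) \<noteq> 5" "odd (wdist (x 3) (y 0))" using xy[of 3 0] odd[of 3 0] by simp_all
    ultimately have "wdist (x 3) (y 0) \<le> 3" by presburger
    moreover have "wdist (x 2) (x 3) + 2 \<le> wdist (x 2) (y 0) + wdist (x 3) (y 0)"
      using detour[of "Inl 2" "Inr 0" "Inl 3"] by (simp add: x_def y_def wdist_commute[of "\<phi> (Inr 0)" "\<phi> (Inl 3)"])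
    ultimately show False using l r A by simp
  qed
qed

text \<open>
  The ladder with two squares is complete bipartite except for the edges from \<open>x\<^sub>0\<close> to \<open>y\<^sub>2\<close> and from \<open>x\<^sub>2\<close>
  to \<open>y\<^sub>0\<close>, and the ladder with one square is a part of it. All \<open>x\<^sub>i\<close> are put next to the word \<open>[0]\<close> and all \<open>y\<^sub>j\<close> at
  distance 2 from it. The branch of \<open>y\<^sub>2\<close> is that of \<open>x\<^sub>0\<close>, and the branch of \<open>y\<^sub>0\<close> is that of \<open>x\<^sub>2\<close>, which
  makes the distance 1 for the two missing edges. The root is the place of \<open>x\<^sub>1\<close>.
\<close>

lemma short_ladder_words:
  assumes "1 \<le> t" "t \<le> 2"
  obtains f :: "nat + nat \<Rightarrow> nat list" where "[] \<in> f ` pverts (ladder t)"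
    "\<forall>u \<in> pverts (ladder t). \<forall>v \<in> pverts (ladder t). (u, v) \<in> parcs (ladder t) \<longleftrightarrow> wdist (f u) (f v) + 2 = 5"
proof -
  define f :: "nat + nat \<Rightarrow> nat list" where
    "f = case_sum (\<lambda>i. if i = 0 then [0, 1] else if i = 1 then [] else [0, 2])
                  (\<lambda>j. if j = 0 then [0, 2, 0] else if j = 1 then [0, 0, 0] else [0, 1, 0])"
  have cases: "i = 0 \<or> i = 1 \<or> i = 2" if "i \<le> t" for i using that assms by linarith
  show ?thesis
  proof (rule that[of f])
    have "Inl 1 \<in> pverts (ladder t)" using assms by (simp add: ladder_simps)
    moreover have "f (Inl 1) = []" by (simp add: f_def)
    ultimately show "[] \<in> f ` pverts (ladder t)" by (metis imageI)
    have small: "i \<in> {0, 1, 2}" if "i \<le> t" for i using cases[OF that] by blast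
    have xy: "wdist (f (Inl i)) (f (Inr j)) = 3 \<longleftrightarrow> \<bar>int i - int j\<bar> \<le> 1"
      and xx: "wdist (f (Inl i)) (f (Inl j)) \<noteq> 3" and yy: "wdist (f (Inr i)) (f (Inr j)) \<noteq> 3"
      if "i \<le> t" "j \<le> t" for i j
      using small[OF that(1)] small[OF that(2)] by (auto simp: f_def)
    have "(u, v) \<in> parcs (ladder t) \<longleftrightarrow> wdist (f u) (f v) + 2 = 5"
      if uv: "u \<in> pverts (ladder t)" "v \<in> pverts (ladder t)" for u v
    proof (cases u; cases v)
      fix i j assume "u = Inl i" "v = Inl j"
      then show ?thesis using uv xx[of i j] by (simp add: ladder_simps image_iff)
    next
      fix i j assume "u = Inl i" "v = Inr j"
      then show ?thesis using uv xy[of i j] by (simp add: ladder_simps image_iff)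
    next
      fix j i assume "u = Inr j" "v = Inl i"
      then show ?thesis using uv xy[of i j] wdist_commute[of "f (Inr j)" "f (Inl i)"] by (simp add: ladder_simps image_iff)
    next
      fix i j assume "u = Inr i" "v = Inr j"
      then show ?thesis using uv yy[of i j] by (simp add: ladder_simps image_iff)
    qed
    then show "\<forall>u \<in> pverts (ladder t). \<forall>v \<in> pverts (ladder t). (u, v) \<in> parcs (ladder t) \<longleftrightarrow> wdist (f u) (f v) + 2 = 5"
      by simp
  qed
qed

section \<open>Rooted placements of a graph\<close>

text \<open>
  Placements for exact 5-leaf powers, where adjacency is distance \<open>5 - 2\<close>. That only \<open>r\<close> lies within
  distance 2 of the root, and that distinct vertices have distinct places, is what makes gluing at \<open>r\<close>
  possible.
\<close>

definition rooted_words :: "'a pair_pre_digraph \<Rightarrow> 'a \<Rightarrow> ('a \<Rightarrow> nat list) \<Rightarrow> bool" where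
  "rooted_words H r f \<longleftrightarrow> f r = [] \<and> inj_on f (pverts H) \<and>
     (\<forall>u \<in> pverts H. u \<noteq> r \<longrightarrow> 3 \<le> length (f u)) \<and>
     (\<forall>u \<in> pverts H. \<forall>v \<in> pverts H. (u, v) \<in> parcs H \<longleftrightarrow> wdist (f u) (f v) = 3)"

definition rootable :: "'a pair_pre_digraph \<Rightarrow> bool" where
  "rootable H \<longleftrightarrow> (\<forall>r \<in> pverts H. \<exists>f. rooted_words H r f)"

text \<open>
  The vertices of the side opposite to the root \<open>r\<close> are the neighbours of the word \<open>[0, 0]\<close>, the
  remaining vertices of the side of \<open>r\<close> lie at distance 2 from \<open>[0, 0]\<close> on separate branches. Either side
  may be empty.
\<close>

lemma complete_bipartite_rootable:
  fixes H :: "'a pair_pre_digraph"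
  assumes fin: "finite (pverts H)" and V: "pverts H = X \<union> Y" "X \<inter> Y = {}"
    and E: "parcs H = X \<times> Y \<union> Y \<times> X"
  shows "rootable H"
proof -
  obtain e :: "'a \<Rightarrow> nat" where "inj_on e (pverts H)"
    using finite_imp_inj_to_nat_seg[OF fin] by metis
  then have e: "e u = e v \<longleftrightarrow> u = v" if "u \<in> pverts H" "v \<in> pverts H" for u v
    using that by (simp add: inj_on_eq_iff)
  have root: "\<exists>f. rooted_words H r f"
    if r: "r \<in> X" and V: "pverts H = X \<union> Y" "X \<inter> Y = {}" and E: "parcs H = X \<times> Y \<union> Y \<times> X" for r X Y
  proof -
    define f where "f u = (if u = r then [] else if u \<in> Y then [0, 0, e u] else [0, 0, e u, 0])" for u
    have "(u, v) \<in> parcs H \<longleftrightarrow> wdist (f u) (f v) = 3" if uv: "u \<in> pverts H" "v \<in> pverts H" for u v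
      using uv r V(2) e[OF uv] unfolding V(1) E f_def by auto
    moreover have "inj_on f (pverts H)" using e by (auto simp: f_def inj_on_def)
    ultimately have "rooted_words H r f" by (auto simp: rooted_words_def f_def)
    then show ?thesis by blast
  qed
  show ?thesis unfolding rootable_def
  proof
    fix r assume "r \<in> pverts H"
    then consider "r \<in> X" | "r \<in> Y" using V by blast
    then show "\<exists>f. rooted_words H r f"
    proof cases
      case 1
      then show ?thesis using V E by (rule root)
    next
      case 2
      then show ?thesis by (rule root) (use V E in auto)
    qed
  qed
qed

section \<open>Even cycles\<close>

text \<open>
  A cycle of length \<open>2 * n + 2\<close> is placed along a path, with vertex 0 near one end. The two directions
  around the cycle become two interleaved tracks: the vertices \<open>1, \<dots>, n + 1\<close> have offsets \<open>0, \<dots>, n\<close>, and the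
  vertices \<open>2 * n + 1, \<dots>, n + 2\<close> have offsets \<open>1, \<dots>, n\<close>.
\<close>

definition cycle_offset :: "nat \<Rightarrow> nat \<Rightarrow> nat" where
  "cycle_offset n i = (if i \<le> n + 1 then i - 1 else 2 * n + 2 - i)"

text \<open>
  A track advances by 2 along the path of the words \<open>replicate m 0\<close> and alternates between words on the
  path, for odd vertices, and words one step beside it, for even vertices. The distance from a path word
  to a word beside the path is 3 exactly if their positions along the path differ by 2, that is, if their
  offsets differ by 1. At equal offset one track is on the path while the other one is beside it, so
  a path word and a word beside the path from different tracks have distance 1 or at least 5. The ends
  are exceptions. Vertex 0 is the root, at distance 3 from the words of offsets 0 and 1. The even vertex
  of offset \<open>n\<close> closes the cycle, so it moves to a place at distance 3 from the odd vertices of offsets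
  \<open>n - 1\<close> and \<open>n\<close>. The word for offset 0 bends off at \<open>[0, 0]\<close>, where the way to the root begins.
\<close>

definition cycle_word :: "nat \<Rightarrow> nat \<Rightarrow> nat list" where
  "cycle_word n i =
     (if i = 0 then []
      else if odd i then
        (if cycle_offset n i = 0 then [0, 0, 1] else replicate (2 * cycle_offset n i + 1) 0)
      else if cycle_offset n i = n then replicate (2 * n) 0 @ [2, 2]
      else replicate (2 * cycle_offset n i + 1) 0 @ [1])"

lemma wdist_replicate:
  fixes x y :: "nat list"
  assumes "x = [] \<or> hd x \<noteq> 0" "y = [] \<or> hd y \<noteq> 0"
  shows "wdist (replicate m 0 @ x) (replicate n 0 @ y) =
    (if m = n then wdist x y else (m - n) + (n - m) + length x + length y)"
proof (induction m n rule: diff_induct)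
  case (1 m)
  then show ?case using assms by (cases m; cases y) auto
next
  case (2 n)
  then show ?case using assms by (cases x) auto
next
  case (3 m n)
  then show ?case by auto
qed

lemma cycle_word_even_length:
  assumes "1 \<le> n" "i < 2 * n + 2"
  shows "even (length (cycle_word n i)) \<longleftrightarrow> even i"
  using assms by (auto simp: cycle_word_def)

lemma cycle_offset_pos:
  assumes "i < 2 * n + 2" "i \<noteq> 0" "i \<noteq> 1"
  shows "1 \<le> cycle_offset n i"
  using assms by (auto simp: cycle_offset_def)

lemma cycle_word_length:
  assumes "1 \<le> n" "i < 2 * n + 2" "i \<noteq> 0"
  shows "3 \<le> length (cycle_word n i)"
proof (cases "odd i")
  case True
  then show ?thesis using assms by (auto simp: cycle_word_def)
next
  case False
  then have "1 \<le> cycle_offset n i" using assms by (intro cycle_offset_pos) auto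
  then show ?thesis using False assms by (auto simp: cycle_word_def)
qed

lemma cycle_offset_eq:
  assumes "i < 2 * n + 2" "j < 2 * n + 2" "i \<noteq> 0" "j \<noteq> 0" "cycle_offset n i = cycle_offset n j" "even i \<longleftrightarrow> even j"
  shows "i = j"
proof -
  have "even (i + j)" using assms(6) by simp
  then have "i + j \<noteq> 2 * n + 3" by (metis even_mult_iff even_add odd_numeral dvd_refl)
  then show ?thesis
    using assms(1-5) unfolding cycle_offset_def by (auto split: if_splits)
qed

lemma cycle_word_inj:
  assumes n: "1 \<le> n" and ij: "i < 2 * n + 2" "j < 2 * n + 2" and eq: "cycle_word n i = cycle_word n j"
  shows "i = j"
proof (cases "i = 0 \<or> j = 0")
  case True
  then show ?thesis using cycle_word_length[OF n ij(1)] cycle_word_length[OF n ij(2)] eq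
    by (cases "i = 0"; cases "j = 0") (auto simp: cycle_word_def[of n 0])
next
  case False
  have parity: "even i \<longleftrightarrow> even j"
    using cycle_word_even_length[OF n ij(1)] cycle_word_even_length[OF n ij(2)] eq by simp
  have "replicate m 0 \<noteq> [0, 0, 1 :: nat]" for m
  proof
    assume "replicate m 0 = [0, 0, 1 :: nat]"
    then have "1 \<in> set (replicate m (0 :: nat))" by simp
    then show False by simp
  qed
  then have "cycle_offset n i = cycle_offset n j"
    using eq False parity arg_cong[OF eq, of last] arg_cong[OF eq, of length]
    unfolding cycle_word_def by (auto simp del: replicate.simps split: if_splits)
  then show ?thesis using cycle_offset_eq[OF ij] False parity by simp
qed

text \<open>
  Vertices of equal parity have even distance, so this is the only case that matters.
\<close>

lemma cycle_word_adjacent_odd_even: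
  assumes n: "1 \<le> n" and i: "i < 2 * n + 2" "odd i" and j: "j < 2 * n + 2" "even j"
  shows "wdist (cycle_word n i) (cycle_word n j) = 3 \<longleftrightarrow>
    j = Suc i \<or> i = Suc j \<or> (i = 2 * n + 1 \<and> j = 0)"
proof -
  define p where "p = cycle_offset n i"
  define q where "q = cycle_offset n j"
  have p: "p \<le> n" and q: "q \<le> n"
    using i j by (auto simp: p_def q_def cycle_offset_def)
  have i0: "i \<noteq> 0" using i by (metis even_zero)
  have wi: "cycle_word n i = (if p = 0 then replicate 2 0 @ [1] else replicate (2 * p + 1) 0 @ [])"
    using i i0 by (simp add: cycle_word_def p_def numeral_2_eq_2)
  show ?thesis
  proof (cases "j = 0")
    case True
    have "wdist (cycle_word n i) (cycle_word n j) = 3 \<longleftrightarrow> p = 0 \<or> p = 1"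
      using True by (simp add: cycle_word_def[of n 0] wi)
    also have "\<dots> \<longleftrightarrow> i = 1 \<or> i = 2 * n + 1"
    proof -
      have "i \<noteq> 2" using i by auto
      then show ?thesis using i(1) i0 n unfolding p_def cycle_offset_def by auto
    qed
    finally show ?thesis using True by auto
  next
    case False
    have wj: "cycle_word n j = (if q = n then replicate (2 * n) 0 @ [2, 2] else replicate (2 * q + 1) 0 @ [1])"
      using j False by (simp add: cycle_word_def q_def)
    have "j \<noteq> 1" using j by auto
    then have q1: "1 \<le> q" using j False cycle_offset_pos by (simp add: q_def)
    have "wdist (cycle_word n i) (cycle_word n j) = 3 \<longleftrightarrow>
      (if q = n then p = q \<or> p + 1 = q else p + 1 = q \<or> q + 1 = p)"
    proof (cases "p = 0")
      case True
      then have wi': "cycle_word n i = replicate 2 0 @ [1]" using wi by simp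
      show ?thesis
      proof (cases "q = n")
        case qn: True
        then have wj': "cycle_word n j = replicate (2 * n) 0 @ [2, 2]" using wj by simp
        show ?thesis unfolding wi' wj' using True qn n q1
          by (subst wdist_replicate) auto
      next
        case qn: False
        then have wj': "cycle_word n j = replicate (2 * q + 1) 0 @ [1]" using wj by simp
        have "(2::nat) \<noteq> 2 * q + 1" by presburger
        then show ?thesis unfolding wi' wj' using True qn n q1
          by (subst wdist_replicate) auto
      qed
    next
      case False
      then have wi': "cycle_word n i = replicate (2 * p + 1) 0 @ []" using wi by simp
      show ?thesis
      proof (cases "q = n")
        case qn: True
        then have wj': "cycle_word n j = replicate (2 * n) 0 @ [2, 2]" using wj by simp
        have "2 * p + 1 \<noteq> 2 * n" by presburger
        then have "wdist (cycle_word n i) (cycle_word n j) = (2 * p + 1 - 2 * n) + (2 * n - (2 * p + 1)) + 2"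
          unfolding wi' wj' by (subst wdist_replicate) simp_all
        then show ?thesis using qn p by auto
      next
        case qn: False
        then have wj': "cycle_word n j = replicate (2 * q + 1) 0 @ [1]" using wj by simp
        have "wdist (cycle_word n i) (cycle_word n j) = (2 * p - 2 * q) + (2 * q - 2 * p) + 1"
          unfolding wi' wj' by (subst wdist_replicate) simp_all
        then show ?thesis using qn by auto
      qed
    qed
    also have "\<dots> \<longleftrightarrow> j = Suc i \<or> i = Suc j"
    proof -
      have "odd (i + j)" using i j by simp
      then have ij: "i + j \<noteq> 2 * n + 2" "i + j \<noteq> 2 * n + 4" "i \<noteq> j" by presburger+
      \<comment> \<open>The cases say on which track each of the two vertices lies.\<close>
      consider "i = p + 1" "j = q + 1" | "i = p + 1" "n + 1 < j" "j + q = 2 * n + 2"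
        | "n + 1 < i" "i + p = 2 * n + 2" "j = q + 1"
        | "i + p = 2 * n + 2" "j + q = 2 * n + 2"
        using i(1) j(1) i0 False unfolding p_def q_def cycle_offset_def
        by (cases "i \<le> n + 1"; cases "j \<le> n + 1") simp_all
      then show ?thesis
      proof cases
        case 1
        then show ?thesis using p q ij(3) by auto
      next
        case 2
        then have "j = Suc i \<longleftrightarrow> p = n \<and> q = n" "i \<noteq> Suc j" "p + 1 \<noteq> q" "q + 1 \<noteq> p"
          using p q ij by linarith+
        then show ?thesis by auto
      next
        case 3
        then have "i = Suc j \<longleftrightarrow> p = n \<and> q = n" "j \<noteq> Suc i" "p + 1 \<noteq> q" "q + 1 \<noteq> p"
          using p q ij by linarith+
        then show ?thesis by auto
      next
        case 4
        then have "i = Suc j \<longleftrightarrow> q = Suc p" "j = Suc i \<longleftrightarrow> p = Suc q" "p \<noteq> q"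
          using ij by linarith+
        then show ?thesis using p by auto
      qed
    qed
    finally show ?thesis using False by simp
  qed
qed

lemma cycle_graph_simps:
  assumes "3 \<le> l"
  shows "pverts (cycle_graph l) = {..<l}"
    "i < l \<Longrightarrow> j < l \<Longrightarrow> (i, j) \<in> parcs (cycle_graph l) \<longleftrightarrow>
      j = Suc i \<or> i = Suc j \<or> (i = l - 1 \<and> j = 0) \<or> (i = 0 \<and> j = l - 1)"
  using assms by (auto simp: cycle_graph_def mod_Suc split: if_splits)

lemma cycle_graph_rooted_words:
  assumes "1 \<le> n"
  shows "rooted_words (cycle_graph (2 * n + 2)) 0 (cycle_word n)"
proof -
  have l: "3 \<le> 2 * n + 2" using assms by simp
  have arc: "(i, j) \<in> parcs (cycle_graph (2 * n + 2)) \<longleftrightarrow> wdist (cycle_word n i) (cycle_word n j) = 3"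
    if ij: "i < 2 * n + 2" "j < 2 * n + 2" for i j
  proof (cases "even i \<longleftrightarrow> even j")
    case True
    then have "even (wdist (cycle_word n i) (cycle_word n j))"
      using assms ij by (simp add: even_wdist_iff cycle_word_even_length)
    then have "wdist (cycle_word n i) (cycle_word n j) \<noteq> 3" by auto
    moreover have "j \<noteq> Suc i" "i \<noteq> Suc j" "\<not> (i = 2 * n + 1 \<and> j = 0)" "\<not> (i = 0 \<and> j = 2 * n + 1)"
      using True by (auto intro: odd_pos)
    ultimately show ?thesis using cycle_graph_simps(2)[OF l ij] by simp
  next
    case False
    then consider "odd i" "even j" | "odd j" "even i" by blast
    then show ?thesis
    proof cases
      case 1
      then have "i \<noteq> 0" by (metis even_zero)
      then show ?thesis
        using cycle_graph_simps(2)[OF l ij] cycle_word_adjacent_odd_even[OF assms ij(1) 1(1) ij(2) 1(2)]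
        by simp
    next
      case 2
      then have "j \<noteq> 0" by (metis even_zero)
      then show ?thesis
        using cycle_graph_simps(2)[OF l ij] cycle_word_adjacent_odd_even[OF assms ij(2) 2(1) ij(1) 2(2)]
          wdist_commute[of "cycle_word n i" "cycle_word n j"] by auto
    qed
  qed
  show ?thesis
    unfolding rooted_words_def cycle_graph_simps(1)[OF l]
    using arc cycle_word_inj[OF assms] cycle_word_length[OF assms]
    by (auto simp: inj_on_def cycle_word_def[of n 0])
qed

text \<open>
  For an automorphism \<open>h\<close> this moves the root.
\<close>

lemma rooted_words_transfer:
  assumes f: "rooted_words H s f" and h: "bij_betw h (pverts H') (pverts H)" "r \<in> pverts H'" "h r = s"
    and E: "\<And>u v. u \<in> pverts H' \<Longrightarrow> v \<in> pverts H' \<Longrightarrow> (u, v) \<in> parcs H' \<longleftrightarrow> (h u, h v) \<in> parcs H"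
  shows "rooted_words H' r (f \<circ> h)"
proof -
  have hV: "h u \<in> pverts H" if "u \<in> pverts H'" for u using h(1) that by (metis bij_betwE)
  have inj: "h u = h v \<longleftrightarrow> u = v" if "u \<in> pverts H'" "v \<in> pverts H'" for u v
    using h(1) that by (metis bij_betw_inv_into_left)
  have "inj_on (f \<circ> h) (pverts H')"
    using f h(1) by (intro comp_inj_on) (simp_all add: rooted_words_def bij_betw_def)
  then show ?thesis
    using f h(2,3) hV inj E unfolding rooted_words_def by auto
qed

text \<open>
  The rotation that maps \<open>r\<close> to 0 reduces every root to the root 0.
\<close>

lemma even_cycle_rootable:
  assumes "3 \<le> l" "even l"
  shows "rootable (cycle_graph l)"
  unfolding rootable_def
proof
  fix r assume "r \<in> pverts (cycle_graph l)"
  then have r: "r < l" by (simp add: cycle_graph_def)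
  obtain n where n: "l = 2 * n + 2" "1 \<le> n"
  proof -
    obtain m where "l = 2 * m" using assms(2) by blast
    then show ?thesis using assms(1) by (intro that[of "m - 1"]) auto
  qed
  define rot where "rot i = (if i < r then i + (l - r) else i - r)" for i
  have lt: "rot i < l" if "i < l" for i using that r by (auto simp: rot_def)
  have next_lt: "Suc i mod l = (if Suc i = l then 0 else Suc i)" if "i < l" for i
    using that by (auto simp: mod_Suc)
  have Suc_rot: "Suc (rot i) mod l = rot (Suc i mod l)" if "i < l" for i
    unfolding next_lt[OF that] next_lt[OF lt[OF that]] using that r by (auto simp: rot_def)
  have inj: "inj_on rot {..<l}" using r by (auto simp: inj_on_def rot_def split: if_splits)
  then have eq: "rot i = rot j \<longleftrightarrow> i = j" if "i < l" "j < l" for i j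
    using that by (simp add: inj_on_eq_iff)
  have "rot ` {..<l} \<subseteq> {..<l}" using lt by auto
  with inj have "bij_betw rot {..<l} {..<l}" by (simp add: bij_betw_def endo_inj_surj)
  moreover have "(i, j) \<in> parcs (cycle_graph l) \<longleftrightarrow> (rot i, rot j) \<in> parcs (cycle_graph l)" if "i < l" "j < l" for i j
    using that lt eq[of j "Suc i mod l"] eq[of i "Suc j mod l"] by (simp add: cycle_graph_def Suc_rot)
  ultimately have "rooted_words (cycle_graph l) r (cycle_word n \<circ> rot)"
    using cycle_graph_rooted_words[OF n(2)] r unfolding n(1)[symmetric]
    by (intro rooted_words_transfer[where s = 0 and H = "cycle_graph l"])
      (simp_all add: cycle_graph_simps(1)[OF assms(1)] rot_def)
  then show "\<exists>f. rooted_words (cycle_graph l) r f" by blast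
qed

text \<open>
  Along the cycle the sides alternate, and the closing edge joins the vertices \<open>l - 1\<close> and 0.
\<close>

lemma bipartite_cycle_even:
  assumes "3 \<le> l" "bipartite (cycle_graph l)"
  shows "even l"
proof -
  obtain X Y where XY: "X \<inter> Y = {}" "parcs (cycle_graph l) \<subseteq> X \<times> Y \<union> Y \<times> X"
    using assms(2) by (auto simp: bipartite_def)
  have flip: "i \<in> X \<longleftrightarrow> j \<notin> X" if "(i, j) \<in> parcs (cycle_graph l)" for i j
    using subsetD[OF XY(2) that] XY(1) by auto
  have alt: "i \<in> X \<longleftrightarrow> (even i \<longleftrightarrow> 0 \<in> X)" if "i < l" for i
    using that
  proof (induction i)
    case (Suc i)
    then have "(i, Suc i) \<in> parcs (cycle_graph l)" using assms(1) by (simp add: cycle_graph_simps)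
    then show ?case using Suc flip[of i "Suc i"] by auto
  qed simp
  have "(0, l - 1) \<in> parcs (cycle_graph l)" using assms(1) by (simp add: cycle_graph_simps)
  then have "odd (l - 1)" using flip[of 0 "l - 1"] alt[of "l - 1"] assms(1) by auto
  then show ?thesis using assms(1) by auto
qed

section \<open>Gluing placements along blocks\<close>

lemma wdist_append_fresh: "y = [] \<or> hd y \<notin> set x \<Longrightarrow> wdist x (p @ y) = wdist x p + length y"
proof (induction x p rule: wdist.induct)
  case (1 p)
  then show ?case by simp
next
  case (2 a x)
  then show ?case by (cases y) auto
next
  case (3 a x b p)
  then show ?case by auto
qed

text \<open>
  The placement \<open>f2\<close> is planted at \<open>f1 c\<close>, with its letters shifted by \<open>N\<close> beyond those of \<open>f1\<close>. A path
  between the parts then passes through \<open>f1 c\<close>. It has length at least \<open>1 + 3\<close> by injectivity of \<open>f1\<close> and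
  because \<open>f2\<close> keeps its vertices away from its root.
\<close>

lemma rooted_words_glue:
  fixes H :: "'a pair_pre_digraph"
  assumes fin: "finite (pverts H)"
    and V: "pverts H = V1 \<union> V2" "V1 \<inter> V2 = {c}"
    and E: "parcs H \<subseteq> V1 \<times> V1 \<union> V2 \<times> V2"
    and f1: "rooted_words (induced H V1) r f1" and r: "r \<in> V1"
    and f2: "rooted_words (induced H V2) c f2"
  shows "\<exists>f. rooted_words H r f"
proof -
  have finV: "finite V1" using fin V by simp
  have "finite (\<Union>u \<in> V1. set (f1 u))" using finV by simp
  then obtain N where N: "\<And>u a. u \<in> V1 \<Longrightarrow> a \<in> set (f1 u) \<Longrightarrow> a < N"
    by (auto simp: finite_nat_set_iff_bounded)
  define f where "f u = (if u \<in> V1 then f1 u else f1 c @ map (\<lambda>a. a + N) (f2 u))" for u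
  have c: "c \<in> V1" "c \<in> V2" using V by auto
  have F1: "f1 r = []" "inj_on f1 V1" "\<And>u. u \<in> V1 \<Longrightarrow> u \<noteq> r \<Longrightarrow> 3 \<le> length (f1 u)"
    "\<And>u v. u \<in> V1 \<Longrightarrow> v \<in> V1 \<Longrightarrow> (u, v) \<in> parcs H \<longleftrightarrow> wdist (f1 u) (f1 v) = 3"
    using f1 by (auto simp: rooted_words_def)
  have F2: "f2 c = []" "inj_on f2 V2" "\<And>u. u \<in> V2 \<Longrightarrow> u \<noteq> c \<Longrightarrow> 3 \<le> length (f2 u)"
    "\<And>u v. u \<in> V2 \<Longrightarrow> v \<in> V2 \<Longrightarrow> (u, v) \<in> parcs H \<longleftrightarrow> wdist (f2 u) (f2 v) = 3"
    using f2 by (auto simp: rooted_words_def)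
  have f_1: "f u = f1 u" if "u \<in> V1" for u using that by (simp add: f_def)
  have f_2: "f u = f1 c @ map (\<lambda>a. a + N) (f2 u)" if "u \<in> V2" for u
    using that V F2(1) by (auto simp: f_def)
  have shift: "inj (\<lambda>a. a + N)" by (simp add: inj_on_def)
  have d1: "wdist (f u) (f v) = wdist (f1 u) (f1 v)" if "u \<in> V1" "v \<in> V1" for u v
    using that by (simp add: f_1)
  have d2: "wdist (f u) (f v) = wdist (f2 u) (f2 v)" if "u \<in> V2" "v \<in> V2" for u v
    using that by (simp add: f_2 wdist_map_inj[OF shift])
  have d12: "wdist (f u) (f v) = wdist (f1 u) (f1 c) + length (f2 v)" if "u \<in> V1" "v \<in> V2" for u v
  proof -
    have "map (\<lambda>a. a + N) (f2 v) = [] \<or> hd (map (\<lambda>a. a + N) (f2 v)) \<notin> set (f1 u)"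
      using N[OF that(1)] by (cases "f2 v") auto
    then show ?thesis using that by (simp add: f_1 f_2 wdist_append_fresh)
  qed
  have far: "4 \<le> wdist (f u) (f v)" if "u \<in> V1" "v \<in> V2" "u \<notin> V2" "v \<notin> V1" for u v
  proof -
    have "u \<noteq> c" "v \<noteq> c" using that c by auto
    then have "f1 u \<noteq> f1 c" using F1(2) that c by (auto dest: inj_onD)
    then have "1 \<le> wdist (f1 u) (f1 c)" by (metis One_nat_def Suc_leI neq0_conv wdist_eq_0_iff)
    then show ?thesis using F2(3)[OF that(2) \<open>v \<noteq> c\<close>] d12[OF that(1,2)] by simp
  qed
  have far': "4 \<le> wdist (f u) (f v)" if "u \<in> V2" "v \<in> V1" "u \<notin> V1" "v \<notin> V2" for u v
    using far[OF that(2,1,4,3)] by (simp add: wdist_commute)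
  have cases: "(u \<in> V1 \<and> v \<in> V1) \<or> (u \<in> V2 \<and> v \<in> V2) \<or>
      (u \<in> V1 \<and> v \<in> V2 \<and> u \<notin> V2 \<and> v \<notin> V1) \<or> (u \<in> V2 \<and> v \<in> V1 \<and> u \<notin> V1 \<and> v \<notin> V2)"
    if "u \<in> pverts H" "v \<in> pverts H" for u v
    using that unfolding V(1) by blast
  have "rooted_words H r f"
    unfolding rooted_words_def
  proof (intro conjI ballI impI)
    show "f r = []" using F1(1) r f_1 by simp
    show "inj_on f (pverts H)"
    proof (rule inj_onI)
      fix u v assume uv: "u \<in> pverts H" "v \<in> pverts H" "f u = f v"
      then have "wdist (f u) (f v) = 0" by simp
      then show "u = v"
        using cases[OF uv(1,2)] far[of u v] far'[of u v] d1[of u v] d2[of u v]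
          inj_onD[OF F1(2), of u v] inj_onD[OF F2(2), of u v] by auto
    qed
    show "3 \<le> length (f u)" if u: "u \<in> pverts H" "u \<noteq> r" for u
    proof (cases "u \<in> V1")
      case True
      then show ?thesis using F1(3) u f_1 by simp
    next
      case False
      then have "u \<in> V2" "u \<noteq> c" using u V c by auto
      then show ?thesis using F2(3)[of u] f_2 by simp
    qed
    show "(u, v) \<in> parcs H \<longleftrightarrow> wdist (f u) (f v) = 3" if uv: "u \<in> pverts H" "v \<in> pverts H" for u v
      using cases[OF uv]
    proof (elim disjE conjE)
      assume a: "u \<in> V1" "v \<in> V2" "u \<notin> V2" "v \<notin> V1"
      then have "(u, v) \<notin> parcs H" using E by blast
      then show ?thesis using far[OF a] by simp
    next
      assume a: "u \<in> V2" "v \<in> V1" "u \<notin> V1" "v \<notin> V2"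
      then have "(u, v) \<notin> parcs H" using E by blast
      then show ?thesis using far'[OF a] by simp
    qed (simp_all add: d1 d2 F1(4) F2(4))
  qed
  then show ?thesis by blast
qed

text \<open>
  The part that contains the desired root stays in place and the other part is planted on it.
\<close>

lemma rootable_glue:
  assumes fin: "finite (pverts H)"
    and V: "pverts H = V1 \<union> V2" "V1 \<inter> V2 = {c}"
    and E: "parcs H \<subseteq> V1 \<times> V1 \<union> V2 \<times> V2"
    and rootable: "rootable (induced H V1)" "rootable (induced H V2)"
  shows "rootable H"
  unfolding rootable_def
proof
  fix r assume "r \<in> pverts H"
  then have r: "r \<in> V1 \<or> r \<in> V2" using V(1) by blast
  have c: "c \<in> V1" "c \<in> V2" using V(2) by auto
  obtain g1 where g1: "rooted_words (induced H V1) c g1" using rootable c by (auto simp: rootable_def)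
  obtain g2 where g2: "rooted_words (induced H V2) c g2" using rootable c by (auto simp: rootable_def)
  from r show "\<exists>f. rooted_words H r f"
  proof
    assume r: "r \<in> V1"
    then obtain f1 where "rooted_words (induced H V1) r f1" using rootable by (auto simp: rootable_def)
    then show ?thesis using rooted_words_glue[OF fin V E _ r g2] by blast
  next
    assume r: "r \<in> V2"
    then obtain f2 where f2: "rooted_words (induced H V2) r f2" using rootable by (auto simp: rootable_def)
    have "pverts H = V2 \<union> V1" "V2 \<inter> V1 = {c}" "parcs H \<subseteq> V2 \<times> V2 \<union> V1 \<times> V1" using V E by auto
    then show ?thesis using rooted_words_glue[OF fin _ _ _ f2 r g1] by blast
  qed
qed

lemma connected_del_vert_iff_cut:
  assumes "wf_digraph D"
  shows "Digraph_Component.connected (pre_digraph.del_vert D v) \<longleftrightarrow> verts D - {v} \<noteq> {} \<and>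
    (\<forall>X \<subset> verts D - {v}. X \<noteq> {} \<longrightarrow>
      (\<exists>a \<in> arcs D. tail D a \<noteq> v \<and> head D a \<noteq> v \<and> (tail D a \<in> X) \<noteq> (head D a \<in> X)))"
  using connected_iff_cut[OF wf_digraph.wf_digraph_del_vert[OF assms], of v]
  by (simp add: pre_digraph.del_vert_simps Bex_def)

text \<open>
  Needed to see that a single vertex is not a block of a larger connected graph.
\<close>

lemma complete_two_nonseparable:
  fixes u v :: 'a
  assumes "u \<noteq> v"
  defines "K \<equiv> with_proj \<lparr> pverts = {u, v}, parcs = {(u, v), (v, u)} \<rparr>"
  shows "graph K" "nonseparable K"
proof -
  have "pair_graph \<lparr> pverts = {u, v}, parcs = {(u, v), (v, u)} \<rparr>"
    using assms by unfold_locales (auto simp: symmetric_def intro!: symI)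
  then show graph: "graph K" unfolding K_def by (rule pair_graph.pair_graphD_graph)
  then have wf: "wf_digraph K" by (simp add: graph_def digraph_def fin_digraph_def)
  show "nonseparable K"
    unfolding nonseparable_def
  proof (intro conjI ballI impI)
    show "Digraph_Component.connected K"
      unfolding connected_iff_cut[OF wf]
    proof (intro conjI allI impI)
      fix X assume "X \<subset> verts K" "X \<noteq> {}"
      then have "(u \<in> X) \<noteq> (v \<in> X)" by (auto simp: K_def)
      then show "\<exists>a \<in> arcs K. (tail K a \<in> X) \<noteq> (head K a \<in> X)" by (simp add: K_def)
    qed (simp add: K_def)
    fix w assume "w \<in> verts K"
    then have single: "\<exists>x. verts K - {w} = {x}" using assms(1) by (auto simp: K_def)
    then show "Digraph_Component.connected (pre_digraph.del_vert K w)"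
      unfolding connected_del_vert_iff_cut[OF wf]
      by (metis insert_not_empty psubset_eq subset_singletonD)
  qed
qed

text \<open>
  \<open>A\<close> is a union of components after the removal of \<open>v\<close>. An arc that leaves a subset of \<open>A\<close> ends in \<open>A\<close> or
  at \<open>v\<close>, which gives connectedness. A block \<open>B\<close> of the side has a vertex in \<open>A\<close>. If a larger
  nonseparable subgraph \<open>D\<close> also had a vertex beyond \<open>v\<close>, then \<open>D\<close> without \<open>v\<close> would be disconnected; so
  \<open>D\<close> lies in the side and equals \<open>B\<close>.
\<close>

lemma (in pair_graph) side_of_cut:
  assumes conn: "Digraph_Component.connected (with_proj G)" and v: "v \<in> pverts G"
    and A: "A \<subseteq> pverts G - {v}" "A \<noteq> {}" and cut: "parcs G \<inter> A \<times> (pverts G - {v} - A) = {}"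
  shows "Digraph_Component.connected (with_proj (induced G (insert v A)))"
    and "is_block B (induced G (insert v A)) \<Longrightarrow> is_block B G"
proof -
  define S where "S = insert v A"
  have S: "S \<subseteq> pverts G" using A v by (auto simp: S_def)
  interpret S: pair_graph "induced G S" using S by (rule pair_graph_induced)
  have G_cut: "\<exists>(x, y) \<in> parcs G. x \<in> X \<and> y \<notin> X" if X: "X \<subset> pverts G" "X \<noteq> {}" for X
  proof -
    obtain a where a: "a \<in> parcs G" "(fst a \<in> X) \<noteq> (snd a \<in> X)"
      using conn X unfolding connected_iff_cut[OF wf_digraph] with_proj_simps by metis
    then have "(fst a, snd a) \<in> parcs G" "(snd a, fst a) \<in> parcs G"
      using arcs_symmetric[of "fst a" "snd a"] by simp_all
    then show ?thesis using a(2) by (cases "fst a \<in> X") force+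
  qed
  have escape: "\<exists>(x, y) \<in> parcs (induced G S). x \<in> X \<and> y \<notin> X" if X: "X \<subseteq> A" "X \<noteq> {}" for X
  proof -
    obtain x y where xy: "(x, y) \<in> parcs G" "x \<in> X" "y \<notin> X"
      using G_cut[of X] X A v by fastforce
    then have "y \<in> S" using cut X in_arcsD2[OF xy(1)] by (auto simp: S_def)
    then show ?thesis using xy X by (auto simp: S_def)
  qed
  show "Digraph_Component.connected (with_proj (induced G (insert v A)))"
    unfolding S_def[symmetric] connected_iff_cut[OF S.wf_digraph]
  proof (intro conjI allI impI)
    fix X assume X: "X \<subset> verts (with_proj (induced G S))" "X \<noteq> {}"
    \<comment> \<open>The side of the cut \<open>X\<close> that avoids \<open>v\<close> is a subset of \<open>A\<close>.\<close>
    define Y where "Y = (if v \<in> X then S - X else X)"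
    have "Y \<subseteq> A" "Y \<noteq> {}" using X by (auto simp: Y_def S_def)
    then obtain x y where "(x, y) \<in> parcs (induced G S)" "x \<in> Y" "y \<notin> Y" using escape by blast
    then have "(x, y) \<in> parcs (induced G S) \<and> (x \<in> X) \<noteq> (y \<in> X)" using X by (auto simp: Y_def split: if_splits)
    then show "\<exists>a \<in> arcs (with_proj (induced G S)).
        (tail (with_proj (induced G S)) a \<in> X) \<noteq> (head (with_proj (induced G S)) a \<in> X)"
      by (intro bexI[of _ "(x, y)"]) auto
  qed (simp add: S_def)
  assume "is_block B (induced G (insert v A))"
  then have block: "subgraph (with_proj B) (with_proj (induced G S))" "graph (with_proj B)" "nonseparable (with_proj B)"
    and max: "\<And>D. D \<noteq> with_proj B \<Longrightarrow> subgraph (with_proj B) D \<Longrightarrow>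
      subgraph D (with_proj (induced G S)) \<Longrightarrow> graph D \<Longrightarrow> nonseparable D \<Longrightarrow> False"
    unfolding is_block_def pre_digraph.max_subgraph_def S_def[symmetric] by (auto simp: pre_digraph.max_subgraph_def)
  have B_ne: "pverts B \<noteq> {}"
    using block(2,3) connected_iff_cut[of "with_proj B"] block(1) by (auto simp: nonseparable_def subgraph_def)
  have B_sub: "pverts B \<subseteq> S" "parcs B \<subseteq> parcs (induced G S)" using block(1) by (auto simp: subgraph_def)
  have "pverts B \<inter> A \<noteq> {}"
  proof
    assume "pverts B \<inter> A = {}"
    then have B: "pverts B = {v}" using B_ne B_sub by (auto simp: S_def)
    then interpret B: pair_graph B using pair_graphI_graph[OF block(2)] by simp
    have Barcs: "parcs B = {}"
    proof (rule equals0I)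
      fix e assume e: "e \<in> parcs B"
      then have "fst e = v" "snd e = v" using B B.arc_fst_in_verts B.arc_snd_in_verts by auto
      then show False using B.no_loops[OF e] by simp
    qed
    obtain x y where xy: "(x, y) \<in> parcs (induced G S)" "x \<in> A" "y \<notin> A" using escape[of A] A(2) by blast
    then have y: "y = v" by (auto simp: S_def)
    have xv: "x \<noteq> v" using xy A by auto
    \<comment> \<open>If \<open>B\<close> were the single vertex \<open>v\<close>, an edge at \<open>v\<close> would be a larger nonseparable subgraph.\<close>
    let ?K = "with_proj \<lparr> pverts = {x, v}, parcs = {(x, v), (v, x)} \<rparr>"
    have K: "graph ?K" "nonseparable ?K" using complete_two_nonseparable[OF xv] by simp_all
    then have wfK: "wf_digraph ?K" by (simp add: graph_def digraph_def fin_digraph_def)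
    have "(v, x) \<in> parcs (induced G S)" using S.arcs_symmetric[OF xy(1)] y by simp
    then have "subgraph ?K (with_proj (induced G S))"
      using xy y wfK S.wf_digraph by (auto simp: subgraph_def S_def)
    moreover have "subgraph (with_proj B) ?K"
      using wfK B.wf_digraph B Barcs by (auto simp: subgraph_def)
    moreover have "?K \<noteq> with_proj B" 
    proof
      assume "?K = with_proj B"
      then have "verts ?K = verts (with_proj B)" by simp
      then show False using B xv by auto
    qed
    ultimately show False using max K by blast
  qed
  then obtain b where b: "b \<in> pverts B" "b \<in> A" by blast
  show "is_block B G"
    unfolding is_block_def pre_digraph.max_subgraph_def
  proof (intro conjI allI impI notI)
    show "subgraph (with_proj B) (with_proj G)"
      using subgraph_induced[OF S] block(1) by (metis subgraph_trans)
    show "graph (with_proj B)" "nonseparable (with_proj B)" using block by simp_all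
    fix D assume "D \<noteq> with_proj B \<and> subgraph (with_proj B) D"
      and "subgraph D (with_proj G) \<and> graph D \<and> nonseparable D"
    then have D: "D \<noteq> with_proj B" "subgraph (with_proj B) D" "subgraph D (with_proj G)" "graph D" "nonseparable D"
      by simp_all
    have wfD: "wf_digraph D" using D(3) by (simp add: subgraph_def)
    have ends: "tail D = fst" "head D = snd" and D_sub: "verts D \<subseteq> pverts G" "arcs D \<subseteq> parcs G"
      using D(3) by (auto simp: subgraph_def compatible_def)
    have bD: "b \<in> verts D" using b D(2) by (auto simp: subgraph_def)
    have no_cross: False
      if "a \<in> arcs D" "fst a \<noteq> v" "snd a \<noteq> v" "(fst a \<in> verts D \<inter> A) \<noteq> (snd a \<in> verts D \<inter> A)" for a
    proof -
      have a: "a \<in> parcs G" "fst a \<in> verts D" "snd a \<in> verts D"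
        using that D_sub wf_digraph.wellformed[OF wfD that(1)] ends by auto
      then have "(snd a, fst a) \<in> parcs G" using arcs_symmetric[of "fst a" "snd a"] by simp
      moreover have "(fst a, snd a) \<in> parcs G" using a by simp
      ultimately show False using that cut a D_sub by blast
    qed
    have "verts D \<subseteq> S"
    proof (rule ccontr)
      assume "\<not> verts D \<subseteq> S"
      then obtain y where y: "y \<in> verts D" "y \<noteq> v" "y \<notin> A" by (auto simp: S_def)
      \<comment> \<open>The vertices of \<open>D\<close> in \<open>A\<close> violate the cut criterion for \<open>D\<close> or for \<open>D\<close> without \<open>v\<close>.\<close>
      have X: "verts D \<inter> A \<noteq> {}" "verts D \<inter> A \<subset> verts D" "verts D \<inter> A \<subset> verts D - {v}"
        using b bD y A by auto
      show False
      proof (cases "v \<in> verts D")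
        case True
        have "verts D \<noteq> {v}" using y by blast
        then have "Digraph_Component.connected (pre_digraph.del_vert D v)"
          using D(5) True by (simp add: nonseparable_def)
        then obtain a where "a \<in> arcs D" "fst a \<noteq> v" "snd a \<noteq> v" "(fst a \<in> verts D \<inter> A) \<noteq> (snd a \<in> verts D \<inter> A)"
          using X unfolding connected_del_vert_iff_cut[OF wfD] ends by metis
        then show False by (rule no_cross)
      next
        case False
        have "Digraph_Component.connected D" using D(5) by (simp add: nonseparable_def)
        then obtain a where a: "a \<in> arcs D" "(fst a \<in> verts D \<inter> A) \<noteq> (snd a \<in> verts D \<inter> A)"
          using X unfolding connected_iff_cut[OF wfD] ends by metis
        moreover have "fst a \<in> verts D" "snd a \<in> verts D" using wf_digraph.wellformed[OF wfD a(1)] ends by auto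
        ultimately show False using no_cross[of a] False by auto
      qed
    qed
    then have "subgraph D (with_proj (induced G S))"
      using D_sub wfD S.wf_digraph ends wf_digraph.wellformed[OF wfD]
      by (fastforce simp: subgraph_def compatible_def)
    then show False using max D by blast
  qed
qed

lemma (in pair_graph) nonseparable_is_block:
  assumes "nonseparable (with_proj G)"
  shows "is_block G G"
  unfolding is_block_def pre_digraph.max_subgraph_def
proof (intro conjI allI impI notI)
  show "subgraph (with_proj G) (with_proj G)" by (rule subgraph_refl)
  show "graph (with_proj G)" by (rule pair_graphD_graph)
  show "nonseparable (with_proj G)" by fact
  fix D assume "D \<noteq> with_proj G \<and> subgraph (with_proj G) D"
    "subgraph D (with_proj G) \<and> graph D \<and> nonseparable D"
  then show False
    by (auto simp: subgraph_def compatible_def intro!: pre_digraph.equality)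
qed

text \<open>
  Induction on the number of vertices. A nonseparable graph is its own block. Otherwise some vertex \<open>v\<close>
  separates the rest into two parts, and each part together with \<open>v\<close> is a smaller connected graph whose
  blocks are blocks of \<open>H\<close>.
\<close>

theorem rootable_if_blocks_rootable:
  assumes "pair_graph H" "Digraph_Component.connected (with_proj H)" "\<And>B. is_block B H \<Longrightarrow> rootable B"
  shows "rootable H"
  using assms
proof (induction "card (pverts H)" arbitrary: H rule: less_induct)
  case less
  interpret pair_graph H by fact
  show ?case
  proof (cases "nonseparable (with_proj H)")
    case True
    then show ?thesis using less.prems(3) nonseparable_is_block by blast
  next
    case False
    then obtain v where v: "v \<in> pverts H" "pverts H \<noteq> {v}"
      "\<not> Digraph_Component.connected (pre_digraph.del_vert (with_proj H) v)"
      using less.prems(2) by (auto simp: nonseparable_def)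
    then have "pverts H - {v} \<noteq> {}" by blast
    with v(3) obtain A where A: "A \<subset> pverts H - {v}" "A \<noteq> {}"
      and no_arc: "\<And>a. a \<in> parcs H \<Longrightarrow> fst a \<noteq> v \<Longrightarrow> snd a \<noteq> v \<Longrightarrow> (fst a \<in> A) = (snd a \<in> A)"
      unfolding connected_del_vert_iff_cut[OF wf_digraph] with_proj_simps by metis
    define A' where "A' = pverts H - {v} - A"
    have A': "A' \<subset> pverts H - {v}" "A' \<noteq> {}" using A by (auto simp: A'_def)
    have cut: "parcs H \<inter> A \<times> (pverts H - {v} - A) = {}" "parcs H \<inter> A' \<times> (pverts H - {v} - A') = {}"
      using no_arc A unfolding A'_def by fastforce+
    have side: "rootable (induced H (insert v S))"
      if S: "S \<subset> pverts H - {v}" "S \<noteq> {}" "parcs H \<inter> S \<times> (pverts H - {v} - S) = {}" for S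
    proof (rule less.hyps)
      have "insert v S \<subset> pverts H" using S v by auto
      then show "card (pverts (induced H (insert v S))) < card (pverts H)"
        using pair_finite_verts by (simp add: psubset_card_mono)
      show "pair_graph (induced H (insert v S))" using S v by (intro pair_graph_induced) auto
      have S': "S \<subseteq> pverts H - {v}" using S by blast
      show "Digraph_Component.connected (with_proj (induced H (insert v S)))"
        by (rule side_of_cut(1)[OF less.prems(2) v(1) S' S(2,3)])
      show "rootable B" if "is_block B (induced H (insert v S))" for B
        using less.prems(3) side_of_cut(2)[OF less.prems(2) v(1) S' S(2,3) that] .
    qed
    show ?thesis
    proof (rule rootable_glue[of H "insert v A" "insert v A'" v])
      show "finite (pverts H)" by (rule pair_finite_verts)
      show "pverts H = insert v A \<union> insert v A'" "insert v A \<inter> insert v A' = {v}"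
        using A v by (auto simp: A'_def)
      show "parcs H \<subseteq> insert v A \<times> insert v A \<union> insert v A' \<times> insert v A'"
      proof
        fix e assume e: "e \<in> parcs H"
        obtain x y where xy: "e = (x, y)" by (cases e)
        then have "x \<in> pverts H" "y \<in> pverts H" "x \<noteq> v \<Longrightarrow> y \<noteq> v \<Longrightarrow> (x \<in> A) = (y \<in> A)"
          using e no_arc[of e] in_arcsD1[of x y] in_arcsD2[of x y] by auto
        then show "e \<in> insert v A \<times> insert v A \<union> insert v A' \<times> insert v A'"
          unfolding xy A'_def by auto
      qed
      show "rootable (induced H (insert v A))" using A cut(1) by (rule side)
      show "rootable (induced H (insert v A'))" using A' cut(2) by (rule side)
    qed
  qed
qed

section \<open>Isomorphic copies and bipartiteness\<close>

text \<open>
  Both graphs have pairs as arcs, so the vertex map determines the arc map.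
\<close>

lemma digraph_iso_with_projE:
  assumes "digraph_iso (with_proj G) (with_proj B)"
  obtains h where "bij_betw h (pverts G) (pverts B)" "parcs G \<subseteq> pverts G \<times> pverts G"
    "\<forall>u \<in> pverts G. \<forall>v \<in> pverts G. (u, v) \<in> parcs G \<longleftrightarrow> (h u, h v) \<in> parcs B"
proof -
  obtain f where f: "pre_digraph.digraph_isomorphism (with_proj G) f" "with_proj B = app_iso f (with_proj G)"
    using assms by (auto simp: digraph_iso_def)
  define h where "h = iso_verts f"
  have "verts (with_proj B) = h ` pverts G" "arcs (with_proj B) = iso_arcs f ` parcs G"
    and ends: "tail (with_proj B) = iso_tail f" "head (with_proj B) = iso_head f"
    unfolding f(2) h_def by simp_all
  then have V: "pverts B = h ` pverts G" and A: "parcs B = iso_arcs f ` parcs G" by simp_all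
  have inj: "inj_on h (pverts G)" and wf: "wf_digraph (with_proj G)"
    and map: "\<And>a. a \<in> parcs G \<Longrightarrow> h (fst a) = fst (iso_arcs f a) \<and> h (snd a) = snd (iso_arcs f a)"
    using f(1) ends unfolding pre_digraph.digraph_isomorphism_def h_def by simp_all
  have sub: "parcs G \<subseteq> pverts G \<times> pverts G"
    using wf_digraph.wellformed[OF wf] by (auto simp: mem_Times_iff)
  have map': "iso_arcs f a = (h (fst a), h (snd a))" if "a \<in> parcs G" for a
    using map[OF that] by (simp add: prod_eq_iff)
  have "(u, v) \<in> parcs G \<longleftrightarrow> (h u, h v) \<in> parcs B" if uv: "u \<in> pverts G" "v \<in> pverts G" for u v
  proof
    assume "(u, v) \<in> parcs G"
    then show "(h u, h v) \<in> parcs B" using map'[of "(u, v)"] unfolding A by force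
  next
    assume "(h u, h v) \<in> parcs B"
    then obtain a where a: "a \<in> parcs G" "iso_arcs f a = (h u, h v)" unfolding A by force
    then have "h (fst a) = h u" "h (snd a) = h v" "fst a \<in> pverts G" "snd a \<in> pverts G"
      using map'[OF a(1)] sub by auto
    then have "fst a = u" "snd a = v" using inj uv by (simp_all add: inj_on_eq_iff)
    then show "(u, v) \<in> parcs G" using a(1) by auto
  qed
  then show ?thesis using that[of h] inj V sub by (simp add: bij_betw_def)
qed

lemma rootable_iso:
  assumes iso: "digraph_iso (with_proj G) (with_proj B)" and "rootable G"
  shows "rootable B"
proof -
  obtain h where h: "bij_betw h (pverts G) (pverts B)"
    "\<forall>u \<in> pverts G. \<forall>v \<in> pverts G. (u, v) \<in> parcs G \<longleftrightarrow> (h u, h v) \<in> parcs B"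
    using iso by (rule digraph_iso_with_projE)
  define g where "g = inv_into (pverts G) h"
  have g: "bij_betw g (pverts B) (pverts G)" unfolding g_def by (rule bij_betw_inv_into[OF h(1)])
  have gV: "g u \<in> pverts G" and hg: "h (g u) = u" if "u \<in> pverts B" for u
    using that g bij_betw_inv_into_right[OF h(1)] by (auto simp: g_def bij_betwE)
  show ?thesis unfolding rootable_def
  proof
    fix r assume r: "r \<in> pverts B"
    then obtain f where "rooted_words G (g r) f" using assms(2) gV by (auto simp: rootable_def)
    then have "rooted_words B r (f \<circ> g)"
      using g r by (rule rooted_words_transfer) (use h(2) gV hg in auto)
    then show "\<exists>f. rooted_words B r f" by blast
  qed
qed

lemma bipartite_hom:
  assumes "bipartite B" and "parcs G \<subseteq> pverts G \<times> pverts G"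
    and "\<And>u. u \<in> pverts G \<Longrightarrow> h u \<in> pverts B"
    and E: "\<And>u v. (u, v) \<in> parcs G \<Longrightarrow> (h u, h v) \<in> parcs B"
  shows "bipartite G"
proof -
  obtain X Y where XY: "pverts B = X \<union> Y" "X \<inter> Y = {}" "parcs B \<subseteq> X \<times> Y \<union> Y \<times> X"
    using assms(1) unfolding bipartite_def by (elim exE conjE)
  let ?X = "{u \<in> pverts G. h u \<in> X}" and ?Y = "{u \<in> pverts G. h u \<in> Y}"
  have "parcs G \<subseteq> ?X \<times> ?Y \<union> ?Y \<times> ?X"
  proof
    fix e assume e: "e \<in> parcs G"
    obtain u v where uv: "e = (u, v)" by (cases e)
    then have "(h u, h v) \<in> X \<times> Y \<union> Y \<times> X" "u \<in> pverts G" "v \<in> pverts G"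
      using E[of u v] e XY(3) assms(2) by auto
    then show "e \<in> ?X \<times> ?Y \<union> ?Y \<times> ?X" unfolding uv by auto
  qed
  moreover have "pverts G = ?X \<union> ?Y" using assms(3) XY(1) by auto
  moreover have "?X \<inter> ?Y = {}" using XY(2) by auto
  ultimately show ?thesis unfolding bipartite_def by blast
qed

lemma bipartite_iso:
  assumes iso: "digraph_iso (with_proj G) (with_proj B)" and "bipartite B"
  shows "bipartite G"
proof -
  obtain h where h: "bij_betw h (pverts G) (pverts B)" "parcs G \<subseteq> pverts G \<times> pverts G"
    "\<forall>u \<in> pverts G. \<forall>v \<in> pverts G. (u, v) \<in> parcs G \<longleftrightarrow> (h u, h v) \<in> parcs B"
    using iso by (rule digraph_iso_with_projE)
  show ?thesis
    by (rule bipartite_hom[OF assms(2) h(2), of h]) (use h bij_betwE in blast)+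
qed

lemma bipartite_block:
  assumes "bipartite H" "is_block B H"
  shows "bipartite B"
proof -
  have sub: "subgraph (with_proj B) (with_proj H)"
    using assms(2) by (simp add: is_block_def pre_digraph.max_subgraph_def)
  then have "wf_digraph (with_proj B)" by (simp add: subgraph_def)
  then have "parcs B \<subseteq> pverts B \<times> pverts B" using wf_digraph.wellformed by (fastforce simp: mem_Times_iff)
  then show ?thesis
    by (rule bipartite_hom[OF assms(1), where h = id]) (use sub in \<open>auto simp: subgraph_def\<close>)
qed

section \<open>Complete multipartite graphs\<close>

lemma complete_multipartite_simps:
  "pverts (complete_multipartite_graph ns) = {(i, a). i < length ns \<and> a < ns ! i}"
  "parcs (complete_multipartite_graph ns) =
     {(u, v). u \<in> pverts (complete_multipartite_graph ns) \<and> v \<in> pverts (complete_multipartite_graph ns) \<and> fst u \<noteq> fst v}"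
  by (auto simp: complete_multipartite_graph_def Let_def)

lemma finite_complete_multipartite: "finite (pverts (complete_multipartite_graph ns))"
proof -
  have "pverts (complete_multipartite_graph ns) = (SIGMA i:{..<length ns}. {..<ns ! i})"
    by (auto simp: complete_multipartite_simps(1))
  then show ?thesis by simp
qed

lemma complete_multipartite_class:
  assumes "\<forall>n \<in> set ns. n \<ge> 1" "i < length ns"
  shows "(i, 0) \<in> pverts (complete_multipartite_graph ns)"
  using assms nth_mem[OF assms(2)] by (fastforce simp: complete_multipartite_simps(1))

text \<open>
  Three classes contain a triangle.
\<close>

lemma bipartite_complete_multipartite:
  assumes ns: "\<forall>n \<in> set ns. n \<ge> 1" and "bipartite (complete_multipartite_graph ns)"
  shows "length ns \<le> 2"
proof (rule ccontr)
  assume "\<not> length ns \<le> 2"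
  then have "(0, 0) \<in> pverts (complete_multipartite_graph ns)" "(1, 0) \<in> pverts (complete_multipartite_graph ns)"
    "(2, 0) \<in> pverts (complete_multipartite_graph ns)"
    using complete_multipartite_class[OF ns, of 0] complete_multipartite_class[OF ns, of 1]
      complete_multipartite_class[OF ns, of 2] by linarith+
  then have E: "((0, 0), (1, 0)) \<in> parcs (complete_multipartite_graph ns)"
    "((1, 0), (2, 0)) \<in> parcs (complete_multipartite_graph ns)"
    "((0, 0), (2, 0)) \<in> parcs (complete_multipartite_graph ns)"
    by (simp_all add: complete_multipartite_simps(2))
  obtain X Y where XY: "X \<inter> Y = {}" "parcs (complete_multipartite_graph ns) \<subseteq> X \<times> Y \<union> Y \<times> X"
    using assms(2) by (auto simp: bipartite_def)
  show False using subsetD[OF XY(2) E(1)] subsetD[OF XY(2) E(2)] subsetD[OF XY(2) E(3)] XY(1) by auto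
qed

lemma rootable_complete_multipartite:
  assumes "length ns \<le> 2"
  shows "rootable (complete_multipartite_graph ns)"
proof (rule complete_bipartite_rootable)
  let ?V = "pverts (complete_multipartite_graph ns)"
  have two: "fst u = 0 \<or> fst u = 1" if "u \<in> ?V" for u
    using that assms by (auto simp: complete_multipartite_simps(1))
  show "finite ?V" by (rule finite_complete_multipartite)
  show "?V = {u \<in> ?V. fst u = 0} \<union> {u \<in> ?V. fst u = 1}" using two by blast
  show "{u \<in> ?V. fst u = 0} \<inter> {u \<in> ?V. fst u = 1} = {}" by auto
  show "parcs (complete_multipartite_graph ns) =
      {u \<in> ?V. fst u = 0} \<times> {u \<in> ?V. fst u = 1} \<union> {u \<in> ?V. fst u = 1} \<times> {u \<in> ?V. fst u = 0}"
  proof -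
    have "fst u \<noteq> fst v \<longleftrightarrow> fst u = 0 \<and> fst v = 1 \<or> fst u = 1 \<and> fst v = 0" if "u \<in> ?V" "v \<in> ?V" for u v
      using two[OF that(1)] two[OF that(2)] by auto
    then have "(u, v) \<in> parcs (complete_multipartite_graph ns) \<longleftrightarrow>
      (u, v) \<in> {u \<in> ?V. fst u = 0} \<times> {u \<in> ?V. fst u = 1} \<union> {u \<in> ?V. fst u = 1} \<times> {u \<in> ?V. fst u = 0}" for u v
      unfolding complete_multipartite_simps(2) by blast
    then show ?thesis by (intro set_eqI) (simp add: split_paired_all)
  qed
qed

lemma wdist_replicate_distinct: "i \<noteq> j \<Longrightarrow> wdist (replicate m i) (replicate m j) = 2 * m"
  by (cases m) auto

text \<open>
  For even \<open>k\<close> the classes are the ends of a spider with legs of length \<open>m = k / 2 - 1\<close>, rooted at the end of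
  class 0. For odd \<open>k\<close> the at most two classes are the ends of a path of length \<open>k - 2\<close>.
\<close>

lemma complete_multipartite_blowup_exact_leaf_power:
  assumes G: "stable_blowup (complete_multipartite_graph ns) G" and k: "3 \<le> k"
    and ns: "ns \<noteq> []" "\<forall>n \<in> set ns. n \<ge> 1" and cond: "even k \<or> length ns \<le> 2"
  shows "exact_leaf_power k G"
proof -
  let ?H = "complete_multipartite_graph ns"
  define m where "m = k div 2 - 1"
  define w :: "nat \<Rightarrow> nat list" where
    "w i = (if i = 0 then [] else if even k then replicate m 0 @ replicate m i else replicate (k - 2) 0)" for i
  have w: "wdist (w i) (w j) + 2 = k \<longleftrightarrow> i \<noteq> j" if "i < length ns" "j < length ns" for i j
  proof (cases "i = j")
    case True
    then show ?thesis using k by auto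
  next
    case False
    show ?thesis
    proof (cases "even k")
      case True
      then have "2 * m + 2 = k" using k by (auto simp: m_def)
      then show ?thesis using True False by (auto simp: w_def wdist_replicate_distinct)
    next
      case odd: False
      then have "i = 0 \<and> j = 1 \<or> i = 1 \<and> j = 0" using that cond False by auto
      then show ?thesis using odd k by (auto simp: w_def)
    qed
  qed
  show ?thesis
  proof (rule blowup_exact_leaf_power[OF G finite_complete_multipartite, of "w \<circ> fst"])
    show "parcs ?H \<subseteq> pverts ?H \<times> pverts ?H" by (auto simp: complete_multipartite_simps(2))
    have "(0, 0) \<in> pverts ?H" using complete_multipartite_class[OF ns(2)] ns(1) by simp
    moreover have "(w \<circ> fst) (0, 0) = []" by (simp add: w_def)
    ultimately show "[] \<in> (w \<circ> fst) ` pverts ?H" by (metis imageI)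
    show "(u, v) \<in> parcs ?H \<longleftrightarrow> wdist ((w \<circ> fst) u) ((w \<circ> fst) v) + 2 = k" if "u \<in> pverts ?H" "v \<in> pverts ?H" for u v
    proof -
      have "fst u < length ns" "fst v < length ns" using that by (auto simp: complete_multipartite_simps(1))
      then show ?thesis using w that by (simp add: complete_multipartite_simps(2))
    qed
  qed
qed

section \<open>Cacti and block-complete multipartite graphs\<close>

lemma single_vertex_rootable:
  assumes "pair_graph H" "card (pverts H) = 1"
  shows "rootable H"
proof -
  interpret pair_graph H by fact
  obtain v where v: "pverts H = {v}" using assms(2) by (auto simp: card_1_singleton_iff)
  have "e \<notin> parcs H" for e
    using arc_fst_in_verts[of e] arc_snd_in_verts[of e] no_loops[of e] v by auto
  then have "parcs H = {}" by blast
  then show ?thesis using v by (intro complete_bipartite_rootable[of H "{v}" "{}"]) auto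
qed

lemma complete_two_rootable:
  assumes "complete_digraph 2 (with_proj B)"
  shows "rootable B"
proof -
  have B: "finite (pverts B)" "card (pverts B) = 2"
    "parcs B = {(u, v). (u, v) \<in> pverts B \<times> pverts B \<and> u \<noteq> v}"
    using assms unfolding complete_digraph_pair_def by simp_all
  obtain x y where "pverts B = {x, y}" "x \<noteq> y" using B(2) by (auto simp: card_2_iff)
  then show ?thesis
    using B(3) by (intro complete_bipartite_rootable[of B "{x}" "{y}"]) auto
qed

lemma bipartite_cactus_rootable:
  assumes "cactus F" "bipartite F"
  shows "rootable F"
proof (cases "card (pverts F) = 1")
  case True
  then show ?thesis using assms(1) by (intro single_vertex_rootable) (simp_all add: cactus_def)
next
  case False
  show ?thesis
  proof (rule rootable_if_blocks_rootable)
    show "pair_graph F" "Digraph_Component.connected (with_proj F)" using assms(1) by (simp_all add: cactus_def)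
    fix B assume B: "is_block B F"
    then have bip: "bipartite B" using assms(2) bipartite_block by metis
    from B False assms(1) consider "complete_digraph 2 (with_proj B)"
      | l where "3 \<le> l" "digraph_iso (with_proj (cycle_graph l)) (with_proj B)"
      unfolding cactus_def by metis
    then show "rootable B"
    proof cases
      case 1
      then show ?thesis by (rule complete_two_rootable)
    next
      case 2
      then have "even l" using bip bipartite_iso bipartite_cycle_even by metis
      then show ?thesis using 2 even_cycle_rootable rootable_iso by metis
    qed
  qed
qed

lemma bipartite_block_complete_multipartite_rootable:
  assumes "block_complete_multipartite H" "bipartite H"
  shows "rootable H"
proof (rule rootable_if_blocks_rootable)
  show "pair_graph H" "Digraph_Component.connected (with_proj H)"
    using assms(1) by (simp_all add: block_complete_multipartite_def)
  fix B assume B: "is_block B H"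
  then have bip: "bipartite B" using assms(2) bipartite_block by metis
  from B assms(1) obtain ns where ns: "\<forall>n \<in> set ns. n \<ge> 1"
    "digraph_iso (with_proj (complete_multipartite_graph ns)) (with_proj B)"
    unfolding block_complete_multipartite_def by metis
  then have "length ns \<le> 2" using bip bipartite_iso bipartite_complete_multipartite by metis
  then show "rootable B" using ns(2) rootable_complete_multipartite rootable_iso by metis
qed

lemma connected_pair_graph_facts:
  assumes "pair_graph H" "Digraph_Component.connected (with_proj H)"
  shows "finite (pverts H)" "pverts H \<noteq> {}" "parcs H \<subseteq> pverts H \<times> pverts H" "\<forall>v. (v, v) \<notin> parcs H"
proof -
  interpret pair_graph H by fact
  show "finite (pverts H)" by (rule pair_finite_verts)
  show "pverts H \<noteq> {}" using assms(2) connected_iff_cut[OF wf_digraph] by simp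
  show "parcs H \<subseteq> pverts H \<times> pverts H" by (auto dest: wellformed')
  show "\<forall>v. (v, v) \<notin> parcs H" using no_loops by fastforce
qed

section \<open>Stable blow-ups that are exact leaf powers\<close>

lemma rootable_blowup:
  assumes G: "stable_blowup H G" and "finite (pverts H)" "pverts H \<noteq> {}" "parcs H \<subseteq> pverts H \<times> pverts H"
    and "rootable H"
  shows "exact_leaf_power 5 G"
proof -
  obtain r where r: "r \<in> pverts H" using assms(3) by blast
  then obtain f where f: "rooted_words H r f" using assms(5) by (auto simp: rootable_def)
  show ?thesis
  proof (rule blowup_exact_leaf_power[OF G assms(2,4), of f])
    show "[] \<in> f ` pverts H" using f r unfolding rooted_words_def by (metis imageI)
    show "(u, v) \<in> parcs H \<longleftrightarrow> wdist (f u) (f v) + 2 = 5" if "u \<in> pverts H" "v \<in> pverts H" for u v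
      using f that by (simp add: rooted_words_def)
  qed
qed

lemma odd_exact_leaf_power_bipartite:
  assumes G: "stable_blowup H G" and wf: "parcs H \<subseteq> pverts H \<times> pverts H"
    and loopfree: "\<forall>v. (v, v) \<notin> parcs H" and k: "odd k" and "exact_leaf_power k G"
  shows "bipartite H"
  using exact_leaf_power_leaf_words[OF assms(5)] leaf_words_blowup[OF G wf] leaf_words_bipartite[OF _ wf loopfree k]
  by metis

lemma exact_5_leaf_power_iff_bipartite:
  assumes G: "stable_blowup H G" and "finite (pverts H)" "pverts H \<noteq> {}" "parcs H \<subseteq> pverts H \<times> pverts H"
    and "\<forall>v. (v, v) \<notin> parcs H" and "bipartite H \<Longrightarrow> rootable H"
  shows "exact_leaf_power 5 G \<longleftrightarrow> bipartite H"
  using rootable_blowup[OF G assms(2,3,4)] odd_exact_leaf_power_bipartite[OF G assms(4,5), of 5] assms(6)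
  by auto

lemma cycle_blowup:
  assumes l: "3 \<le> l" and G: "stable_blowup (cycle_graph l) G"
  shows "exact_leaf_power 5 G \<longleftrightarrow> even l"
proof -
  have "Suc i mod l \<noteq> i" if "i < l" for i using l that by (simp add: mod_Suc)
  then have "\<forall>v. (v, v) \<notin> parcs (cycle_graph l)" by (auto simp: cycle_graph_def dest: sym)
  then have "exact_leaf_power 5 G \<longleftrightarrow> bipartite (cycle_graph l)"
    using l bipartite_cycle_even even_cycle_rootable
    by (intro exact_5_leaf_power_iff_bipartite[OF G]) (auto simp: cycle_graph_def lessThan_empty_iff)
  moreover have "exact_leaf_power 5 G" if "even l"
    using l even_cycle_rootable[OF l that]
    by (intro rootable_blowup[OF G]) (auto simp: cycle_graph_def lessThan_empty_iff)
  ultimately show ?thesis using bipartite_cycle_even[OF l] by blast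
qed

lemma ladder_blowup:
  fixes G :: "'b pair_pre_digraph"
  assumes t: "1 \<le> t" and G: "stable_blowup (ladder t) G"
  shows "exact_leaf_power 5 G \<longleftrightarrow> t \<le> 2"
proof
  assume "exact_leaf_power 5 G"
  then obtain \<psi> :: "'b \<Rightarrow> ('b + nat) list" where "leaf_words 5 G \<psi>"
    using exact_leaf_power_leaf_words by metis
  then obtain \<phi> where "leaf_words 5 (ladder t) (\<psi> \<circ> \<phi>)"
    using leaf_words_blowup[OF G parcs_ladder_subset] by metis
  then show "t \<le> 2" using long_ladder_no_leaf_words by (metis not_less_eq_eq numeral_2_eq_2 numeral_3_eq_3)
next
  assume "t \<le> 2"
  then obtain f :: "nat + nat \<Rightarrow> nat list" where "[] \<in> f ` pverts (ladder t)"
    "\<forall>u \<in> pverts (ladder t). \<forall>v \<in> pverts (ladder t). (u, v) \<in> parcs (ladder t) \<longleftrightarrow> wdist (f u) (f v) + 2 = 5"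
    using t by (metis short_ladder_words)
  then show "exact_leaf_power 5 G"
    by (intro blowup_exact_leaf_power[OF G _ parcs_ladder_subset, of f]) (simp_all add: ladder_simps(1))
qed

lemma complete_multipartite_blowup:
  assumes k: "3 \<le> k" and ns: "ns \<noteq> []" "\<forall>n \<in> set ns. n \<ge> 1"
    and G: "stable_blowup (complete_multipartite_graph ns) G"
  shows "exact_leaf_power k G \<longleftrightarrow> even k \<or> length ns \<le> 2"
proof
  assume elp: "exact_leaf_power k G"
  have "length ns \<le> 2" if "odd k"
  proof (rule bipartite_complete_multipartite[OF ns(2)])
    show "bipartite (complete_multipartite_graph ns)"
      by (rule odd_exact_leaf_power_bipartite[OF G _ _ that elp]) (auto simp: complete_multipartite_simps(2))
  qed
  then show "even k \<or> length ns \<le> 2" by blast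
next
  assume "even k \<or> length ns \<le> 2"
  then show "exact_leaf_power k G" by (rule complete_multipartite_blowup_exact_leaf_power[OF G k ns])
qed

theorem corollary7p4:
  shows
    "(\<forall>l \<ge> 3. \<forall>G :: 'b pair_pre_digraph. stable_blowup (cycle_graph l) G \<longrightarrow>
        (exact_leaf_power 5 G \<longleftrightarrow> even l)) \<and>
     (\<forall>t \<ge> 1. \<forall>G :: 'b pair_pre_digraph. stable_blowup (ladder t) G \<longrightarrow>
        (exact_leaf_power 5 G \<longleftrightarrow> t \<le> 2)) \<and>
     (\<forall>F :: 'a pair_pre_digraph. cactus F \<longrightarrow>
        (\<forall>G :: 'b pair_pre_digraph. stable_blowup F G \<longrightarrow>
           (exact_leaf_power 5 G \<longleftrightarrow> bipartite F))) \<and>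
     (\<forall>k \<ge> 3. \<forall>ns. ns \<noteq> [] \<and> (\<forall>n \<in> set ns. n \<ge> 1) \<longrightarrow>
        (\<forall>G :: 'b pair_pre_digraph. stable_blowup (complete_multipartite_graph ns) G \<longrightarrow>
           (exact_leaf_power k G \<longleftrightarrow> even k \<or> length ns \<le> 2))) \<and>
     (\<forall>H :: 'a pair_pre_digraph. block_complete_multipartite H \<longrightarrow>
        (\<forall>G :: 'b pair_pre_digraph. stable_blowup H G \<longrightarrow>
           (exact_leaf_power 5 G \<longleftrightarrow> bipartite H)))"
proof (intro conjI allI impI)
  fix l and G :: "'b pair_pre_digraph" assume "3 \<le> l" "stable_blowup (cycle_graph l) G"
  then show "exact_leaf_power 5 G \<longleftrightarrow> even l" by (rule cycle_blowup)
next
  fix t and G :: "'b pair_pre_digraph" assume "1 \<le> t" "stable_blowup (ladder t) G"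
  then show "exact_leaf_power 5 G \<longleftrightarrow> t \<le> 2" by (rule ladder_blowup)
next
  fix F :: "'a pair_pre_digraph" and G :: "'b pair_pre_digraph" assume F: "cactus F" and G: "stable_blowup F G"
  then have "pair_graph F" "Digraph_Component.connected (with_proj F)" by (simp_all add: cactus_def)
  then show "exact_leaf_power 5 G \<longleftrightarrow> bipartite F"
    by (intro exact_5_leaf_power_iff_bipartite[OF G] connected_pair_graph_facts bipartite_cactus_rootable F)
next
  fix k :: nat and ns :: "nat list" and G :: "'b pair_pre_digraph"
  assume "3 \<le> k" "ns \<noteq> [] \<and> (\<forall>n \<in> set ns. n \<ge> 1)" "stable_blowup (complete_multipartite_graph ns) G"
  then show "exact_leaf_power k G \<longleftrightarrow> even k \<or> length ns \<le> 2" by (intro complete_multipartite_blowup) simp_all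
next
  fix H :: "'a pair_pre_digraph" and G :: "'b pair_pre_digraph"
  assume H: "block_complete_multipartite H" and G: "stable_blowup H G"
  then have "pair_graph H" "Digraph_Component.connected (with_proj H)" by (simp_all add: block_complete_multipartite_def)
  then show "exact_leaf_power 5 G \<longleftrightarrow> bipartite H"
    by (intro exact_5_leaf_power_iff_bipartite[OF G] connected_pair_graph_facts
        bipartite_block_complete_multipartite_rootable H)
qed

end
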